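(* The Lie algebra $\mathfrak{N}$ is generated by $\mathcal{M}\cup\mathcal{N}\cup\mathfrak{N}_{[0]}$, where $$\mathcal{M}=\{\mathrm{D_H}(x^{(q_i\varepsilon_i)}): 1\le q_i\le\pi_i,\ i\in Y_0\},\qquad \mathcal{N}=\{\mathrm{D_H}(x_ix^u): i\in Y_0,\ u\in\mathbb{B}_2\},$$ and $\mathfrak{N}_{[0]}$ is the component of $\mathfrak{N}$ of $\mathbb{Z}$-degree $0$.
   Context: Let $\mathbb{F}$ be a field of characteristic $p>3$, and let $m>1$, $n>3$ be integers. Put $Y_0=\{1,\dots,2m\}$, $Y_1=\{2m+1,\dots,2m+n\}$, $Y=Y_0\cup Y_1$. Fix $\underline t=(t_1,\dots,t_{2m})$ with positive integer entries, $\pi_i=p^{t_i}-1$, $\pi=(\pi_1,\dots,\pi_{2m})$, $\mathbb{A}=\{\alpha\in\mathbb{N}_0^{2m}:\alpha_i\le\pi_i\}$, $|\alpha|=\sum\alpha_i$; $\varepsilon_i$ is the $i$-th unit vector. $\mathbb{B}_k$ is the set of strictly increasing $k$-tuples $u=\langle i_1,\dots,i_k\rangle$ in $Y_1$ (also viewed as subsets), $|u|=k$, $\mathbb{B}=\bigcup_{k=0}^n\mathbb{B}_k$, $\mathbb{B}^0=\{u\in\mathbb{B}: |u|\text{ even}\}$, $x^u=x_{i_1}\cdots x_{i_k}$, $x^{\emptyset}=1$, $\omega=\langle 2m+1,\dots,2m+n\rangle$ (so $|\omega|=n$). $\mathcal{O}=\mathcal{O}(2m,n;\underline t)$ is the associative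 superalgebra with basis $\{x^{(\alpha)}x^u:\alpha\in\mathbb{A},u\in\mathbb{B}\}$ and products $x^{(\alpha)}x^{(\beta)}=\prod_i\binom{\alpha_i+\beta_i}{\alpha_i}x^{(\alpha+\beta)}$ (zero if $\alpha+\beta\notin\mathbb{A}$), $x_kx_l=-x_lx_k$, $x_k^2=0$ for $k,l\in Y_1$, $x^{(\alpha)}x_k=x_kx^{(\alpha)}$; write $x_i=x^{(\varepsilon_i)}$ for $i\in Y_0$. The parity of $x^{(\alpha)}x^u$ is $|u|$ mod 2 and its $\mathbb{Z}$-degree is $|\alpha|+|u|$. The superderivations $\partial_i$ ($i\in Y$) are $\partial_i(x^{(\alpha)}x^u)=x^{(\alpha-\varepsilon_i)}x^u$ for $i\in Y_0$ (zero if $\alpha_i=0$), and $\partial_i(x^{(\alpha)}x^u)=x^{(\alpha)}\,\partial x^u/\partial x_i$ (left derivative) for $i\in Y_1$; $\mu(i)=\overline 0$ for $i\in Y_0$, $\mu(i)=\overline 1$ for $i\in Y_1$ is the parity of $\partial_i$. $W=\{\sum_{i\in Y}a_i\partial_i: a_i\in\mathcal{O}\}$ is the generalized Witt Lie superalgebra, with bracket $[a\partial_i,b\partial_j]=a\partial_i(b)\partial_j-(-1)^{\mathrm p(a\partial_i)\mathrm p(b\partial_j)}b\partial_j(a)\partial_i$, where $\mathrm p(a\partial_i)=\mathrm p(a)+\mu(i)$. It is $\mathbb{Z}$-graded: $W_{[k]}$ is spanned by $f\partial_s$ with $f\in\mathcal{O}$ homogeneous of degree $k+1$, $s\in Y$.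 For $i\in Y_0$: $i'=i+m$, $\tau(i)=1$ if $i\le m$; $i'=i-m$, $\tau(i)=-1$ if $m<i\le 2m$; for $i\in Y_1$: $i'=i$, $\tau(i)=1$. Define the linear map $\mathrm{D_H}:\mathcal{O}\to W$ by $\mathrm{D_H}(a)=\sum_{i\in Y}\tau(i)(-1)^{\mu(i)\mathrm p(a)}\partial_i(a)\partial_{i'}$ for homogeneous $a$. Let $$\mathfrak{N}=\mathrm{span}_{\mathbb{F}}\{\mathrm{D_H}(x^{(\alpha)}x^u):\alpha\in\mathbb{A},u\in\mathbb{B}^0,(\alpha,u)\ne(\pi,\omega),(\alpha,u)\ne(\pi,\emptyset)\},$$ a $\mathbb{Z}$-graded Lie algebra (with the grading inherited from $W$, so $\mathrm{D_H}(x^{(\alpha)}x^u)$ has degree $|\alpha|+|u|-2$). *)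

theory Defs
  imports Complex_Main "HOL.Hull" "HOL-Library.Function_Algebras"
begin

text \<open>
  The monomial $x^{(\alpha)} x^u$ is indexed by the pair \<open>(\<alpha>, u)\<close>: a multi-index is a function
  on all of \<open>nat\<close> that vanishes outside \<open>Y0\<close>, and a strictly increasing tuple in \<open>Y1\<close> is
  represented by its set of entries.  Elements of the superalgebra are coefficient functions on such
  pairs, and $\sum_i a_i \partial_i$ is represented by the family of its coefficients \<open>a i\<close>
  (the Witt superalgebra is free over the superalgebra on the $\partial_i$).
\<close>

type_synonym midx = "(nat \<Rightarrow> nat) \<times> nat set"
type_synonym 'a salg = "midx \<Rightarrow> 'a"
type_synonym 'a witt = "nat \<Rightarrow> 'a salg"

definition scaleO :: "'a::field \<Rightarrow> 'a salg \<Rightarrow> 'a salg" where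
  "scaleO c f = (\<lambda>k. c * f k)"

definition scaleW :: "'a::field \<Rightarrow> 'a witt \<Rightarrow> 'a witt" where
  "scaleW c X = (\<lambda>i k. c * X i k)"

interpretation witt: vector_space "scaleW :: 'a::field \<Rightarrow> 'a witt \<Rightarrow> 'a witt"
  by unfold_locales (auto simp: scaleW_def fun_eq_iff algebra_simps)

definition mon :: "midx \<Rightarrow> 'a::field salg" where
  "mon a = (\<lambda>k. if k = a then 1 else 0)"

definition eps :: "nat \<Rightarrow> nat \<Rightarrow> nat" where
  "eps i = (\<lambda>j. if j = i then 1 else 0)"

text \<open>\<open>dterm a i\<close> is $a\,\partial_i$.\<close>

definition dterm :: "'a::field salg \<Rightarrow> nat \<Rightarrow> 'a witt" where
  "dterm a i = (\<lambda>j. if j = i then a else 0)"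

text \<open>
  Sorting the product $x^u x^v$ of disjoint \<open>u\<close>, \<open>v\<close> into increasing order costs one sign for each
  inversion, that is, for each pair $(k, l) \in u \times v$ with $l < k$.
\<close>

definition inversions :: "nat set \<Rightarrow> nat set \<Rightarrow> nat" where
  "inversions u v = card {(k, l). k \<in> u \<and> l \<in> v \<and> l < k}"

context
  fixes p m n :: nat and t :: "nat \<Rightarrow> nat"
begin

definition Y0 :: "nat set" where "Y0 = {1..2*m}"
definition Y1 :: "nat set" where "Y1 = {2*m+1..2*m+n}"
definition Y :: "nat set" where "Y = Y0 \<union> Y1"

definition pimax :: "nat \<Rightarrow> nat" where
  "pimax = (\<lambda>i. if i \<in> Y0 then p ^ t i - 1 else 0)"

definition AA :: "(nat \<Rightarrow> nat) set" where
  "AA = {\<alpha>. (\<forall>i\<in>Y0. \<alpha> i \<le> pimax i) \<and> (\<forall>i. i \<notin> Y0 \<longrightarrow> \<alpha> i = 0)}"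

definition BBk :: "nat \<Rightarrow> nat set set" where
  "BBk k = {u. u \<subseteq> Y1 \<and> card u = k}"

definition BB :: "nat set set" where
  "BB = (\<Union>k\<in>{0..n}. BBk k)"

definition BB0 :: "nat set set" where
  "BB0 = {u \<in> BB. even (card u)}"

definition basis :: "midx set" where
  "basis = AA \<times> BB"

definition Oalg :: "'a::field salg set" where
  "Oalg = {f. \<forall>k. k \<notin> basis \<longrightarrow> f k = 0}"

definition mono_mult :: "midx \<Rightarrow> midx \<Rightarrow> 'a::field salg" where
  "mono_mult = (\<lambda>(\<alpha>, u) (\<beta>, v).
     if \<alpha> + \<beta> \<in> AA \<and> u \<inter> v = {}
     then scaleO ((\<Prod>i\<in>Y0. of_nat ((\<alpha> i + \<beta> i) choose \<alpha> i)) * (-1) ^ inversions u v)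
            (mon (\<alpha> + \<beta>, u \<union> v))
     else 0)"

definition omult :: "'a::field salg \<Rightarrow> 'a salg \<Rightarrow> 'a salg" where
  "omult f g = (\<Sum>a\<in>basis. \<Sum>b\<in>basis. scaleO (f a * g b) (mono_mult a b))"

definition mu :: "nat \<Rightarrow> nat" where
  "mu i = (if i \<in> Y1 then 1 else 0)"

text \<open>Left derivative for \<open>i \<in> Y1\<close>: move $x_i$ to the front of $x^u$, then delete it.\<close>

definition mono_partial :: "nat \<Rightarrow> midx \<Rightarrow> 'a::field salg" where
  "mono_partial i = (\<lambda>(\<alpha>, u).
     if i \<in> Y0 then (if \<alpha> i = 0 then 0 else mon (\<alpha> - eps i, u))
     else if i \<in> u then scaleO ((-1) ^ card {k \<in> u. k < i}) (mon (\<alpha>, u - {i}))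
     else 0)"

definition partial :: "nat \<Rightarrow> 'a::field salg \<Rightarrow> 'a salg" where
  "partial i f = (\<Sum>a\<in>basis. scaleO (f a) (mono_partial i a))"

definition WW :: "'a::field witt set" where
  "WW = {X. (\<forall>i\<in>Y. X i \<in> Oalg) \<and> (\<forall>i. i \<notin> Y \<longrightarrow> X i = 0)}"

text \<open>
  The bracket is given for homogeneous coefficients; it is stated here for monomials, where
  \<open>card (snd a)\<close> represents the parity of \<open>a\<close>, and extended bilinearly.
\<close>

definition mono_bracket :: "midx \<Rightarrow> nat \<Rightarrow> midx \<Rightarrow> nat \<Rightarrow> 'a::field witt" where
  "mono_bracket a i b j =
     dterm (omult (mon a) (partial i (mon b))) j
     - scaleW ((-1) ^ ((card (snd a) + mu i) * (card (snd b) + mu j)))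
         (dterm (omult (mon b) (partial j (mon a))) i)"

definition bracket :: "'a::field witt \<Rightarrow> 'a witt \<Rightarrow> 'a witt" where
  "bracket X Z = (\<Sum>i\<in>Y. \<Sum>j\<in>Y. \<Sum>a\<in>basis. \<Sum>b\<in>basis.
     scaleW (X i a * Z j b) (mono_bracket a i b j))"

definition lie_subalgebra :: "'a::field witt set \<Rightarrow> bool" where
  "lie_subalgebra L \<longleftrightarrow>
     L \<subseteq> WW \<and> witt.subspace L \<and> (\<forall>X\<in>L. \<forall>Z\<in>L. bracket X Z \<in> L)"

definition ohomogeneous :: "int \<Rightarrow> 'a::field salg \<Rightarrow> bool" where
  "ohomogeneous d f \<longleftrightarrow>
     f \<in> Oalg \<and> (\<forall>\<alpha> u. f (\<alpha>, u) \<noteq> 0 \<longrightarrow> int ((\<Sum>i\<in>Y0. \<alpha> i) + card u) = d)"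

definition Wcomp :: "int \<Rightarrow> 'a::field witt set" where
  "Wcomp k = witt.span {dterm f s | f s. ohomogeneous (k + 1) f \<and> s \<in> Y}"

definition prime_idx :: "nat \<Rightarrow> nat" where
  "prime_idx i = (if i \<in> Y0 then (if i \<le> m then i + m else i - m) else i)"

definition tau :: "nat \<Rightarrow> 'a::field" where
  "tau i = (if i \<in> Y0 \<and> m < i then -1 else 1)"

definition mono_DH :: "midx \<Rightarrow> 'a::field witt" where
  "mono_DH a = (\<Sum>i\<in>Y. scaleW (tau i * (-1) ^ (mu i * card (snd a)))
     (dterm (partial i (mon a)) (prime_idx i)))"

definition DH :: "'a::field salg \<Rightarrow> 'a witt" where
  "DH f = (\<Sum>a\<in>basis. scaleW (f a) (mono_DH a))"

text \<open>The index of $x^\omega$ is \<open>Y1\<close>.\<close>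

definition NN :: "'a::field witt set" where
  "NN = witt.span {DH (mon (\<alpha>, u)) | \<alpha> u. \<alpha> \<in> AA \<and> u \<in> BB0 \<and>
     (\<alpha>, u) \<noteq> (pimax, Y1) \<and> (\<alpha>, u) \<noteq> (pimax, {})}"

definition NNcomp :: "int \<Rightarrow> 'a::field witt set" where
  "NNcomp k = NN \<inter> Wcomp k"

definition gensM :: "'a::field witt set" where
  "gensM = {DH (mon (\<lambda>j. q * eps i j, {})) | i q. i \<in> Y0 \<and> 1 \<le> q \<and> q \<le> pimax i}"

definition gensN :: "'a::field witt set" where
  "gensN = {DH (omult (mon (eps i, {})) (mon (0, u))) | i u. i \<in> Y0 \<and> u \<in> BBk 2}"

end

end

theory Submission
  imports Defs "HOL-Computational_Algebra.Primes"
begin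

text \<open>
  Write $\{f, g\} = \sum_i \tau(i)\, \partial_i f\, \partial_{i'} g$ for the Poisson bracket on the
  even part of the superalgebra.  The Hamiltonian map turns it into the bracket of Witt fields,
  $[D_H f, D_H g] = D_H \{f, g\}$ (\<open>bracket_D\<close>); this needs only that the $\partial_i$ are
  supercommuting superderivations of a supercommutative product.  The theorem therefore becomes a
  statement about monomials and their Poisson brackets.

  The span is closed under the bracket because neither $x^{(\pi)}x^\omega$ nor $x^{(\pi)}$ ever
  appears in $\{f, g\}$ (\<open>poisson_top\<close>).  The summands with \<open>i \<in> Y0\<close> add up to the divergence
  $\sum_i \tau(i)\, \partial_i(f\, \partial_{i'} g)$, since the terms $f\, \partial_i\partial_{i'} g$
  cancel in pairs, and a derivative $\partial_i h$ has no monomial with the full exponent $\pi_i$ at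
  \<open>i\<close>.  A summand with \<open>i \<in> Y1\<close> is the product of $\partial_i f$ and $\partial_i g$, which are
  free of $x_i$ and odd, so it contains neither $x^\omega$ nor a monomial without odd variables.

  For generation, let \<open>L\<close> be a subalgebra containing the generators.  Many brackets of two monomials
  are scalar multiples of one monomial, and the scalar is a product of binomial coefficients that does
  not vanish as soon as an exponent reaches its maximum, because $\binom{p^t - 1}{k} \equiv (-1)^k$
  modulo $p$.  Each such bracket is a move between monomials in \<open>L\<close>: \<open>inL_raise\<close>,
  \<open>inL_transfer\<close>, \<open>inL_union\<close> and \<open>inL_contract_top\<close>.

  Among the $x^{(\alpha)}$ in \<open>L\<close>, one of maximal degree admits no move that raises the degree.
  This forces all its exponents, up to a single deficit of one, to be maximal
  (\<open>exists_submaximal\<close>); the moves carry the deficit to every other position, and bracketing with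
  the $x_i$ lowers exponents, which gives all $x^{(\alpha)}$ with $\alpha \ne \pi$ (\<open>inL_even\<close>).
  Odd variables then enter in pairs: bracketing $x^{(\alpha)}x^v$ with $x_i x_k x_l$ adjoins $x_k x_l$
  at the cost of one even exponent, and this loss is repaired by a bracket that contracts an odd
  variable occurring in both factors.  The repair uses an odd variable outside the monomial under
  construction, so it works for every $x^u$ except $x^\omega$, where only exponents other than
  $\pi$ are claimed.
\<close>

section \<open>Pointwise evaluation\<close>

interpretation salg: vector_space "scaleO :: 'a::field \<Rightarrow> 'a salg \<Rightarrow> 'a salg"
  by unfold_locales (auto simp: scaleO_def fun_eq_iff algebra_simps)

lemma sum_apply: "(\<Sum>i\<in>S. f i) x = (\<Sum>i\<in>S. f i x)"
  by (induction S rule: infinite_finite_induct) auto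

lemma scaleO_apply: "scaleO c f k = c * f k"
  by (simp add: scaleO_def)

lemma scaleW_apply: "scaleW c X i = scaleO c (X i)"
  by (simp add: scaleW_def scaleO_def)

lemma dterm_apply: "dterm f i j = (if j = i then f else 0)"
  by (simp add: dterm_def)

lemma dterm_sum: "dterm (\<Sum>a\<in>S. f a) i = (\<Sum>a\<in>S. dterm (f a) i)"
  by (auto simp: dterm_def fun_eq_iff sum_apply)

lemma dterm_scale: "dterm (scaleO c f) i = scaleW c (dterm f i)"
  by (auto simp: dterm_def fun_eq_iff scaleW_apply scaleO_apply)

section \<open>Signs of reordered products\<close>

lemma inversions_remove_left:
  assumes "finite u" "finite v" "k \<in> u"
  shows "inversions u v = inversions (u - {k}) v + card {l \<in> v. l < k}"
proof -
  define S where "S = {(j, l). j \<in> u - {k} \<and> l \<in> v \<and> l < j}"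
  have "finite S"
    by (rule finite_subset[of _ "u \<times> v"]) (use assms in \<open>auto simp: S_def\<close>)
  then have "card (S \<union> Pair k ` {l \<in> v. l < k}) = card S + card (Pair k ` {l \<in> v. l < k})"
    using assms by (intro card_Un_disjoint) (auto simp: S_def)
  moreover have "S \<union> Pair k ` {l \<in> v. l < k} = {(j, l). j \<in> u \<and> l \<in> v \<and> l < j}"
    using assms by (auto simp: S_def)
  moreover have "card (Pair k ` {l \<in> v. l < k}) = card {l \<in> v. l < k}"
    by (rule card_image) (simp add: inj_on_def)
  ultimately show ?thesis
    unfolding inversions_def S_def by (simp only:)
qed

lemma inversions_remove_right:
  assumes "finite u" "finite v" "k \<in> v"
  shows "inversions u v = inversions u (v - {k}) + card {j \<in> u. k < j}"
proof -
  define S where "S = {(j, l). j \<in> u \<and> l \<in> v - {k} \<and> l < j}"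
  have "finite S"
    by (rule finite_subset[of _ "u \<times> v"]) (use assms in \<open>auto simp: S_def\<close>)
  then have "card (S \<union> (\<lambda>j. (j, k)) ` {j \<in> u. k < j}) = card S + card ((\<lambda>j. (j, k)) ` {j \<in> u. k < j})"
    using assms by (intro card_Un_disjoint) (auto simp: S_def)
  moreover have "S \<union> (\<lambda>j. (j, k)) ` {j \<in> u. k < j} = {(j, l). j \<in> u \<and> l \<in> v \<and> l < j}"
    using assms by (auto simp: S_def)
  moreover have "card ((\<lambda>j. (j, k)) ` {j \<in> u. k < j}) = card {j \<in> u. k < j}"
    by (rule card_image) (simp add: inj_on_def)
  ultimately show ?thesis
    unfolding inversions_def S_def by (simp only:)
qed

lemma inversions_swap:
  assumes "finite u" "finite v" "u \<inter> v = {}"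
  shows "inversions u v + inversions v u = card u * card v"
proof -
  define S where "S = {(j, l). j \<in> u \<and> l \<in> v \<and> l < j}"
  define S' where "S' = {(j, l). j \<in> u \<and> l \<in> v \<and> j < l}"
  define T where "T = {(j, l). j \<in> v \<and> l \<in> u \<and> l < j}"
  have "S' = prod.swap ` T"
    unfolding S'_def T_def by auto
  then have T: "card S' = card T"
    using card_image[OF inj_swap] by (simp only:)
  have "j < l \<or> l < j" if "j \<in> u" "l \<in> v" for j l
  proof -
    have "j \<noteq> l" using assms(3) that by blast
    then show ?thesis by linarith
  qed
  then have "u \<times> v = S \<union> S'"
    unfolding S_def S'_def by auto
  moreover have "S \<inter> S' = {}"
    unfolding S_def S'_def by auto
  moreover have "finite (u \<times> v)"
    using assms by simp
  ultimately have "card (u \<times> v) = card S + card S'"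
    by (simp only: card_Un_disjoint finite_Un)
  moreover have "inversions u v = card S" "inversions v u = card T"
    unfolding inversions_def S_def T_def by (rule refl)+
  ultimately show ?thesis
    using T card_cartesian_product[of u v] by linarith
qed

lemma card_below_above:
  assumes "finite (u :: nat set)"
  shows "card {j \<in> u. j < k} + card {j \<in> u. k < j} = card (u - {k})"
proof -
  have "card ({j \<in> u. j < k} \<union> {j \<in> u. k < j}) = card {j \<in> u. j < k} + card {j \<in> u. k < j}"
    using assms by (intro card_Un_disjoint) auto
  moreover have "{j \<in> u. j < k} \<union> {j \<in> u. k < j} = u - {k}" by auto
  ultimately show ?thesis by (simp only:)
qed

lemma card_below_Un:
  assumes "finite (u :: nat set)" "finite v" "u \<inter> v = {}"
  shows "card {j \<in> u \<union> v. j < k} = card {j \<in> u. j < k} + card {j \<in> v. j < k}"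
proof -
  have "card ({j \<in> u. j < k} \<union> {j \<in> v. j < k}) = card {j \<in> u. j < k} + card {j \<in> v. j < k}"
    using assms by (intro card_Un_disjoint) auto
  moreover have "{j \<in> u. j < k} \<union> {j \<in> v. j < k} = {j \<in> u \<union> v. j < k}" by auto
  ultimately show ?thesis by (simp only:)
qed

lemma card_below_remove:
  assumes "finite (u :: nat set)" "i \<in> u"
  shows "card {j \<in> u. j < k} = card {j \<in> u - {i}. j < k} + (if i < k then 1 else 0)"
proof (cases "i < k")
  case True
  have "insert i {j \<in> u - {i}. j < k} = {j \<in> u. j < k}" using True assms by auto
  moreover have "card (insert i {j \<in> u - {i}. j < k}) = Suc (card {j \<in> u - {i}. j < k})"
    using assms by (intro card_insert_disjoint) auto
  ultimately show ?thesis using True by simp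
next
  case False
  then have "{j \<in> u - {i}. j < k} = {j \<in> u. j < k}" by auto
  then show ?thesis using False by simp
qed

section \<open>Binomial coefficients in prime characteristic\<close>

text \<open>
  Absorption gives \<open>k * (p ^ e choose k) = p ^ e * ((p ^ e - 1) choose (k - 1))\<close>; if the binomial
  coefficient were prime to \<open>p\<close>, all of \<open>p ^ e\<close> would have to divide \<open>k\<close>.
\<close>

lemma prime_power_dvd_choose:
  fixes p :: nat
  assumes "prime p" "0 < k" "k < p ^ e"
  shows "p dvd (p ^ e choose k)"
proof (rule ccontr)
  assume "\<not> p dvd (p ^ e choose k)"
  then have "coprime (p ^ e) (p ^ e choose k)"
    using assms(1) by (simp add: prime_imp_coprime)
  moreover have "k * (p ^ e choose k) = p ^ e * ((p ^ e - 1) choose (k - 1))"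
    using assms by (intro times_binomial_minus1_eq) auto
  then have "p ^ e dvd k * (p ^ e choose k)" by simp
  ultimately have "p ^ e dvd k"
    by (simp add: coprime_dvd_mult_left_iff)
  then show False using assms by (auto dest: dvd_imp_le)
qed

lemma of_nat_choose_prime_power:
  assumes "prime p" "CHAR('a::semiring_1) = p" "0 < k" "k < p ^ e"
  shows "of_nat (p ^ e choose k) = (0 :: 'a)"
  using prime_power_dvd_choose[OF assms(1,3,4)] assms(2) of_nat_eq_0_iff_char_dvd by blast

text \<open>
  Adjacent entries of row \<open>p ^ e - 1\<close> of Pascal's triangle add up to an entry of row \<open>p ^ e\<close>,
  which vanishes in the ring, so the entries alternate between \<open>1\<close> and \<open>-1\<close>.  All nonvanishing
  arguments about structure constants rest on this.
\<close>

lemma of_nat_choose_prime_power_minus_one: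
  assumes "prime p" "CHAR('a::ring_1) = p" "k < p ^ e"
  shows "of_nat ((p ^ e - 1) choose k) = ((-1) ^ k :: 'a)"
  using assms(3)
proof (induction k)
  case (Suc k)
  have "p ^ e choose Suc k = ((p ^ e - 1) choose k) + ((p ^ e - 1) choose Suc k)"
    using Suc.prems by (cases "p ^ e") auto
  then have "(0 :: 'a) = of_nat ((p ^ e - 1) choose k) + of_nat ((p ^ e - 1) choose Suc k)"
    using of_nat_choose_prime_power[OF assms(1,2), of "Suc k" e] Suc.prems
    by (simp flip: of_nat_add)
  then show ?case using Suc by (simp add: eq_neg_iff_add_eq_0 add.commute)
qed simp

section \<open>Index sets and the monomial basis\<close>

text \<open>
  The token \<open>scalars\<close> names the coefficient field, which occurs in the types of no other parameter.
\<close>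

locale hamiltonian_data =
  fixes p m n :: nat and t :: "nat \<Rightarrow> nat" and scalars :: "'a::field itself"
  assumes char: "CHAR('a) = p" and p_gt: "p > 3" and m_gt: "m > 1" and n_gt: "n > 3"
    and t_pos: "\<forall>i\<in>Y0 m. t i > 0"
begin

abbreviation Ie :: "nat set" where "Ie \<equiv> Y0 m"
abbreviation Io :: "nat set" where "Io \<equiv> Y1 m n"
abbreviation I :: "nat set" where "I \<equiv> Y m n"
abbreviation \<pi> :: "nat \<Rightarrow> nat" where "\<pi> \<equiv> pimax p m t"
abbreviation A :: "(nat \<Rightarrow> nat) set" where "A \<equiv> AA p m t"
abbreviation Bas :: "midx set" where "Bas \<equiv> basis p m n t"
abbreviation alg :: "'a salg set" where "alg \<equiv> Oalg p m n t"
abbreviation salg_mult :: "'a salg \<Rightarrow> 'a salg \<Rightarrow> 'a salg" (infixl "\<odot>" 70)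
  where "f \<odot> g \<equiv> omult p m n t f g"
abbreviation pd :: "nat \<Rightarrow> 'a salg \<Rightarrow> 'a salg" ("\<partial>") where "\<partial> \<equiv> partial p m n t"
abbreviation par :: "nat \<Rightarrow> nat" where "par \<equiv> mu m n"
abbreviation dual :: "nat \<Rightarrow> nat" where "dual \<equiv> prime_idx m"
abbreviation sg :: "nat \<Rightarrow> 'a" where "sg \<equiv> tau m"
abbreviation D :: "'a salg \<Rightarrow> 'a witt" where "D \<equiv> DH p m n t"
abbreviation brk :: "'a witt \<Rightarrow> 'a witt \<Rightarrow> 'a witt" where "brk \<equiv> bracket p m n t"

lemma prime_p: "prime p"
  using prime_CHAR_semidom[where 'a = 'a] char p_gt by auto

lemma \<pi>_eq: "i \<in> Ie \<Longrightarrow> \<pi> i = p ^ t i - 1"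
  by (simp add: pimax_def)

lemma \<pi>_Suc: "i \<in> Ie \<Longrightarrow> Suc (\<pi> i) = p ^ t i"
  using p_gt by (simp add: pimax_def)

lemma \<pi>_ge: "i \<in> Ie \<Longrightarrow> 3 \<le> \<pi> i"
proof -
  assume i: "i \<in> Ie"
  then have "p ^ 1 \<le> p ^ t i"
    using t_pos p_gt by (intro power_increasing) (auto simp: Suc_leI)
  then show ?thesis using p_gt \<pi>_Suc[OF i] by simp
qed

lemma finite_Ie [simp]: "finite Ie" and finite_Io [simp]: "finite Io"
  and finite_I [simp]: "finite I" and card_Io: "card Io = n"
  by (simp_all add: Y0_def Y1_def Y_def)

lemma Ie_Io_disjoint: "i \<in> Ie \<Longrightarrow> i \<notin> Io"
  by (auto simp: Y0_def Y1_def)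

lemma I_cases: "i \<in> I \<longleftrightarrow> i \<in> Ie \<or> i \<in> Io"
  by (simp add: Y_def)

lemma par_simps: "i \<in> Ie \<Longrightarrow> par i = 0" "i \<in> Io \<Longrightarrow> par i = 1"
  using Ie_Io_disjoint by (auto simp: mu_def)

lemma in_A_iff: "\<alpha> \<in> A \<longleftrightarrow> (\<forall>i. \<alpha> i \<le> \<pi> i)"
  by (auto simp: AA_def pimax_def)

lemma A_outside: "\<alpha> \<in> A \<Longrightarrow> i \<notin> Ie \<Longrightarrow> \<alpha> i = 0"
  by (auto simp: AA_def)

lemma Bas_eq: "Bas = A \<times> Pow Io"
proof -
  have "BB m n = Pow Io"
    using card_mono[OF finite_Io] card_Io by (auto simp: BB_def BBk_def)
  then show ?thesis by (simp add: basis_def)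
qed

lemma finite_A [simp]: "finite A"
proof -
  let ?F = "{f. \<forall>i. (i \<in> Ie \<longrightarrow> f i \<in> {..Max (\<pi> ` Ie)}) \<and> (i \<notin> Ie \<longrightarrow> f i = 0)}"
  have "finite ?F"
    by (rule finite_set_of_finite_funs) auto
  moreover have "A \<subseteq> ?F"
  proof
    fix \<alpha> assume \<alpha>: "\<alpha> \<in> A"
    have "\<alpha> i \<le> Max (\<pi> ` Ie)" if "i \<in> Ie" for i
    proof -
      have "\<alpha> i \<le> \<pi> i" using \<alpha> by (simp add: in_A_iff)
      also have "\<pi> i \<le> Max (\<pi> ` Ie)" using that by simp
      finally show ?thesis .
    qed
    then show "\<alpha> \<in> ?F" using A_outside[OF \<alpha>] by blast
  qed
  ultimately show ?thesis by (rule rev_finite_subset)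
qed

lemma finite_Bas [simp]: "finite Bas"
  by (simp add: Bas_eq)

lemma dual_I: "i \<in> I \<Longrightarrow> dual i \<in> I"
  and dual_Ie: "i \<in> Ie \<Longrightarrow> dual i \<in> Ie"
  and dual_Io: "i \<in> Io \<Longrightarrow> dual i = i"
  and dual_dual: "i \<in> I \<Longrightarrow> dual (dual i) = i"
  and dual_neq: "i \<in> Ie \<Longrightarrow> dual i \<noteq> i"
  by (auto simp: Y_def Y0_def Y1_def prime_idx_def)

lemma par_dual: "i \<in> I \<Longrightarrow> par (dual i) = par i"
  using dual_Ie dual_Io by (auto simp: I_cases par_simps)

text \<open>
  The pairing is skew on the even indices and symmetric on the odd ones.
\<close>

lemma sg_dual: "i \<in> I \<Longrightarrow> sg (dual i) = - ((-1) ^ par i * sg i)"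
  by (auto simp: tau_def I_cases par_simps dual_Io) (auto simp: prime_idx_def Y0_def Y1_def)

lemma sg_neq_0 [simp]: "sg i \<noteq> 0"
  by (simp add: tau_def)

lemma bij_dual: "bij_betw dual I I"
  by (rule bij_betw_byWitness[where f' = dual]) (auto simp: dual_I dual_dual)

lemma sum_dual: "(\<Sum>i\<in>I. F (dual i)) = (\<Sum>i\<in>I. F i)"
  by (rule sum.reindex_bij_betw[OF bij_dual])

section \<open>Linear extension from monomials\<close>

lemma omult_add_left: "(f + g) \<odot> h = f \<odot> h + g \<odot> h"
  and omult_add_right: "h \<odot> (f + g) = h \<odot> f + h \<odot> g"
  by (simp_all add: omult_def salg.scale_left_distrib algebra_simps sum.distrib)

lemma omult_scale_left: "scaleO c f \<odot> h = scaleO c (f \<odot> h)"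
  and omult_scale_right: "h \<odot> scaleO c f = scaleO c (h \<odot> f)"
  by (simp_all add: omult_def salg.scale_sum_right scaleO_apply algebra_simps)

lemma omult_zero [simp]: "0 \<odot> f = 0" "f \<odot> 0 = 0"
  by (simp_all add: omult_def)

lemma omult_sum_left: "(\<Sum>a\<in>S. F a) \<odot> h = (\<Sum>a\<in>S. F a \<odot> h)"
  and omult_sum_right: "h \<odot> (\<Sum>a\<in>S. F a) = (\<Sum>a\<in>S. h \<odot> F a)"
  by (induction S rule: infinite_finite_induct) (auto simp: omult_add_left omult_add_right)

lemma pd_add: "\<partial> i (f + g) = \<partial> i f + \<partial> i g"
  by (simp add: partial_def salg.scale_left_distrib sum.distrib)

lemma pd_scale: "\<partial> i (scaleO c f) = scaleO c (\<partial> i f)"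
  by (simp add: partial_def salg.scale_sum_right scaleO_apply)

lemma pd_zero [simp]: "\<partial> i 0 = 0"
  by (simp add: partial_def)

lemma pd_sum: "\<partial> i (\<Sum>a\<in>S. F a) = (\<Sum>a\<in>S. \<partial> i (F a))"
  by (induction S rule: infinite_finite_induct)
    (simp_all only: pd_add pd_zero sum.empty sum.insert sum.infinite not_False_eq_True)

lemma scaleO_mon_apply: "scaleO (mon a b) F = (if b = a then F else 0)"
  by (simp add: mon_def)

lemma pd_mon: "a \<in> Bas \<Longrightarrow> \<partial> i (mon a) = mono_partial m i a"
  by (simp add: partial_def scaleO_mon_apply sum.delta)

lemma omult_mon: "a \<in> Bas \<Longrightarrow> b \<in> Bas \<Longrightarrow> mon a \<odot> mon b = mono_mult p m t a b"
proof -
  assume ab: "a \<in> Bas" "b \<in> Bas"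
  have "mon a \<odot> mon b = (\<Sum>x\<in>Bas. \<Sum>y\<in>Bas. scaleO (mon a x) (scaleO (mon b y) (mono_mult p m t x y)))"
    by (simp add: omult_def)
  also have "\<dots> = (\<Sum>x\<in>Bas. scaleO (mon a x) (\<Sum>y\<in>Bas. scaleO (mon b y) (mono_mult p m t x y)))"
    by (simp only: salg.scale_sum_right)
  also have "\<dots> = mono_mult p m t a b"
    using ab by (simp add: scaleO_mon_apply sum.delta)
  finally show ?thesis .
qed

definition has_parity :: "nat \<Rightarrow> 'a salg \<Rightarrow> bool" where
  "has_parity e f \<longleftrightarrow> (\<forall>a. f a \<noteq> 0 \<longrightarrow> a \<in> Bas \<and> even (card (snd a) + e))"

lemma has_parity_alg: "has_parity e f \<Longrightarrow> f \<in> alg"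
  by (auto simp: has_parity_def Oalg_def)

lemma alg_expand:
  assumes "f \<in> alg"
  shows "f = (\<Sum>a\<in>Bas. scaleO (f a) (mon a))"
proof
  fix b
  have "(\<Sum>a\<in>Bas. scaleO (f a) (mon a)) b = (\<Sum>a\<in>Bas. if a = b then f b else 0)"
    unfolding sum_apply by (rule sum.cong) (auto simp: scaleO_apply mon_def)
  also have "\<dots> = f b"
    using assms by (cases b) (auto simp: Oalg_def sum.delta)
  finally show "f b = (\<Sum>a\<in>Bas. scaleO (f a) (mon a)) b" by simp
qed

text \<open>
  Identities between products and derivatives are linear in each homogeneous argument; this rule
  reduces them to monomials of the given parity.
\<close>

lemma parity_induct [consumes 1, case_names zero add mon]:
  assumes "has_parity e f" and "P 0" and "\<And>f g. P f \<Longrightarrow> P g \<Longrightarrow> P (f + g)"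
    and "\<And>c a. a \<in> Bas \<Longrightarrow> even (card (snd a) + e) \<Longrightarrow> P (scaleO c (mon a))"
  shows "P f"
proof -
  have "P (\<Sum>a\<in>S. scaleO (f a) (mon a))" if "finite S" for S
    using that
  proof (induction S)
    case (insert a S)
    have "P (scaleO (f a) (mon a))"
      using assms(1,2,4) unfolding has_parity_def by (cases "f a = 0") (simp, blast)
    from assms(3)[OF this insert.IH] show ?case
      using insert.hyps by (simp only: sum.insert not_False_eq_True)
  qed (simp only: sum.empty assms(2))
  then show ?thesis
    using alg_expand[OF has_parity_alg[OF assms(1)]] by (metis finite_Bas)
qed

lemma has_parity_zero [simp]: "has_parity e 0"
  by (simp add: has_parity_def)

lemma has_parity_add: "has_parity e f \<Longrightarrow> has_parity e g \<Longrightarrow> has_parity e (f + g)"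
  unfolding has_parity_def by (metis add.right_neutral plus_fun_apply)

lemma has_parity_scale: "has_parity e f \<Longrightarrow> has_parity e (scaleO c f)"
  by (auto simp: has_parity_def scaleO_apply)

lemma has_parity_sum: "(\<And>a. a \<in> S \<Longrightarrow> has_parity e (F a)) \<Longrightarrow> has_parity e (\<Sum>a\<in>S. F a)"
  by (induction S rule: infinite_finite_induct) (auto simp: has_parity_add)

lemma has_parity_mon: "a \<in> Bas \<Longrightarrow> even (card (snd a) + e) \<Longrightarrow> has_parity e (mon a)"
  by (auto simp: has_parity_def mon_def split: if_splits)

section \<open>Products and derivatives of monomials\<close>

definition binom_prod :: "(nat \<Rightarrow> nat) \<Rightarrow> (nat \<Rightarrow> nat) \<Rightarrow> 'a" where
  "binom_prod \<alpha> \<beta> = (\<Prod>i\<in>Ie. of_nat ((\<alpha> i + \<beta> i) choose \<alpha> i))"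

definition shuffle_sign :: "nat set \<Rightarrow> nat set \<Rightarrow> 'a" where
  "shuffle_sign u v = (if u \<inter> v = {} then (-1) ^ inversions u v else 0)"

text \<open>
  With monomials beyond the truncation set to zero, the product formula needs no case distinction.
\<close>

definition trunc_mon :: "(nat \<Rightarrow> nat) \<Rightarrow> nat set \<Rightarrow> 'a salg" where
  "trunc_mon \<gamma> w = (if \<gamma> \<in> A then mon (\<gamma>, w) else 0)"

lemma omult_mon_eq:
  assumes "\<alpha> \<in> A" "\<beta> \<in> A" "u \<subseteq> Io" "v \<subseteq> Io"
  shows "mon (\<alpha>, u) \<odot> mon (\<beta>, v) = scaleO (binom_prod \<alpha> \<beta> * shuffle_sign u v) (trunc_mon (\<alpha> + \<beta>) (u \<union> v))"
  using assms by (subst omult_mon)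
    (auto simp: Bas_eq mono_mult_def binom_prod_def shuffle_sign_def trunc_mon_def)

lemma pd_mon_even:
  assumes "\<alpha> \<in> A" "u \<subseteq> Io" "k \<in> Ie"
  shows "\<partial> k (mon (\<alpha>, u)) = (if \<alpha> k = 0 then 0 else mon (\<alpha> - eps k, u))"
  using assms by (subst pd_mon) (auto simp: Bas_eq mono_partial_def)

lemma pd_mon_odd:
  assumes "\<alpha> \<in> A" "u \<subseteq> Io" "k \<in> Io"
  shows "\<partial> k (mon (\<alpha>, u)) =
    (if k \<in> u then scaleO ((-1) ^ card {j \<in> u. j < k}) (mon (\<alpha>, u - {k})) else 0)"
  using assms Ie_Io_disjoint by (subst pd_mon) (auto simp: Bas_eq mono_partial_def)

lemma A_minus_eps: "\<alpha> \<in> A \<Longrightarrow> \<alpha> - eps k \<in> A"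
  by (auto simp: in_A_iff fun_diff_def intro: le_trans[OF diff_le_self])

lemma minus_eps_add: "0 < \<alpha> k \<Longrightarrow> \<alpha> - eps k + \<beta> = \<alpha> + \<beta> - eps k"
  and add_minus_eps: "0 < \<beta> k \<Longrightarrow> \<alpha> + (\<beta> - eps k) = \<alpha> + \<beta> - eps k"
  by (auto simp: fun_eq_iff eps_def)

lemma binom_prod_commute: "binom_prod \<alpha> \<beta> = binom_prod \<beta> \<alpha>"
  unfolding binom_prod_def by (intro prod.cong refl) (metis add.commute binomial_symmetric diff_add_inverse le_add1)

lemma shuffle_sign_commute:
  assumes "finite u" "finite v"
  shows "shuffle_sign v u = (-1) ^ (card u * card v) * shuffle_sign u v"
proof (cases "u \<inter> v = {}")
  case True
  then show ?thesis
    using inversions_swap[OF assms True]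
    by (auto simp: shuffle_sign_def Int_commute minus_one_power_iff even_add simp flip: even_mult_iff)
       (metis even_add)+
qed (auto simp: shuffle_sign_def)

lemma binom_prod_split:
  assumes "k \<in> Ie"
  shows "binom_prod \<alpha> \<beta> = of_nat ((\<alpha> k + \<beta> k) choose \<alpha> k) * (\<Prod>i\<in>Ie - {k}. of_nat ((\<alpha> i + \<beta> i) choose \<alpha> i))"
  unfolding binom_prod_def using assms by (simp add: prod.remove)

text \<open>
  Pascal's rule at \<open>k\<close>, in a form that survives truncation: when \<open>\<alpha> + \<beta>\<close> leaves \<open>A\<close> only at \<open>k\<close>,
  the two products on the right add up to a multiple of $\binom{p^{t_k}}{\alpha_k}$, which is zero in
  the field.  This is why the truncated algebra still has the derivation $\partial_k$.
\<close>

lemma binom_prod_pascal: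
  assumes "\<alpha> \<in> A" "\<beta> \<in> A" "k \<in> Ie" "\<alpha> + \<beta> - eps k \<in> A" "0 < \<alpha> k + \<beta> k"
  shows "(if \<alpha> + \<beta> \<in> A then binom_prod \<alpha> \<beta> else 0) =
    (if \<alpha> k = 0 then 0 else binom_prod (\<alpha> - eps k) \<beta>) + (if \<beta> k = 0 then 0 else binom_prod \<alpha> (\<beta> - eps k))"
proof -
  define R :: 'a where "R = (\<Prod>i\<in>Ie - {k}. of_nat ((\<alpha> i + \<beta> i) choose \<alpha> i))"
  have R: "binom_prod \<alpha> \<beta> = of_nat ((\<alpha> k + \<beta> k) choose \<alpha> k) * R"
    unfolding R_def by (rule binom_prod_split[OF assms(3)])
  have Ra: "binom_prod (\<alpha> - eps k) \<beta> = of_nat ((\<alpha> k - 1 + \<beta> k) choose (\<alpha> k - 1)) * R"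
    unfolding R_def by (subst binom_prod_split[OF assms(3)]) (simp add: eps_def cong: prod.cong_simp)
  have Rb: "binom_prod \<alpha> (\<beta> - eps k) = of_nat ((\<alpha> k + (\<beta> k - 1)) choose \<alpha> k) * R"
    unfolding R_def by (subst binom_prod_split[OF assms(3)]) (simp add: eps_def cong: prod.cong_simp)
  have le: "\<alpha> i + \<beta> i \<le> \<pi> i" if "i \<noteq> k" for i
    using assms(4) that by (auto simp: in_A_iff eps_def dest: spec[of _ i])
  have ab: "\<alpha> k \<le> \<pi> k" "\<beta> k \<le> \<pi> k" "\<alpha> k + \<beta> k \<le> Suc (\<pi> k)"
    using assms(1,2,4) by (auto simp: in_A_iff eps_def dest: spec[of _ k])
  have in_A: "\<alpha> + \<beta> \<in> A \<longleftrightarrow> \<alpha> k + \<beta> k \<le> \<pi> k"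
    using le by (auto simp: in_A_iff) metis
  have pascal: "((\<alpha> k + \<beta> k) choose \<alpha> k) = ((\<alpha> k - 1 + \<beta> k) choose (\<alpha> k - 1)) + ((\<alpha> k + (\<beta> k - 1)) choose \<alpha> k)"
    if "\<alpha> k \<noteq> 0" "\<beta> k \<noteq> 0"
    using that by (cases "\<alpha> k"; cases "\<beta> k") auto
  have top: "of_nat ((\<alpha> k + \<beta> k) choose \<alpha> k) = (0 :: 'a)" if "\<alpha> + \<beta> \<notin> A" "\<alpha> k \<noteq> 0" "\<beta> k \<noteq> 0"
  proof -
    have "\<alpha> k + \<beta> k = p ^ t k"
      using that ab in_A \<pi>_Suc[OF assms(3)] by simp
    then show ?thesis
      using of_nat_choose_prime_power[OF prime_p char, of "\<alpha> k" "t k"] that by simp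
  qed
  consider "\<alpha> k = 0" "\<beta> k \<noteq> 0" | "\<alpha> k \<noteq> 0" "\<beta> k = 0" | "\<alpha> k \<noteq> 0" "\<beta> k \<noteq> 0"
    using assms(5) by fastforce
  then show ?thesis
  proof cases
    case 3
    have "binom_prod (\<alpha> - eps k) \<beta> + binom_prod \<alpha> (\<beta> - eps k) = of_nat ((\<alpha> k + \<beta> k) choose \<alpha> k) * R"
      unfolding Ra Rb pascal[OF 3] by (simp add: algebra_simps)
    then show ?thesis using 3 R top by auto
  qed (use ab in_A R Ra Rb in auto)
qed

lemma leibniz_mon_even:
  assumes "\<alpha> \<in> A" "\<beta> \<in> A" "u \<subseteq> Io" "v \<subseteq> Io" "k \<in> Ie"
  shows "\<partial> k (mon (\<alpha>, u) \<odot> mon (\<beta>, v)) =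
    \<partial> k (mon (\<alpha>, u)) \<odot> mon (\<beta>, v) + mon (\<alpha>, u) \<odot> \<partial> k (mon (\<beta>, v))"
proof -
  define \<delta> where "\<delta> = \<alpha> + \<beta> - eps k"
  have w: "u \<union> v \<subseteq> Io" using assms by auto
  have L: "\<partial> k (mon (\<alpha>, u) \<odot> mon (\<beta>, v)) =
      (if \<alpha> + \<beta> \<in> A \<and> 0 < \<alpha> k + \<beta> k then scaleO (binom_prod \<alpha> \<beta> * shuffle_sign u v) (trunc_mon \<delta> (u \<union> v)) else 0)"
    using assms w A_minus_eps[of "\<alpha> + \<beta>" k]
    by (auto simp: omult_mon_eq pd_scale trunc_mon_def pd_mon_even \<delta>_def)
  have R1: "\<partial> k (mon (\<alpha>, u)) \<odot> mon (\<beta>, v) =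
      (if \<alpha> k = 0 then 0 else scaleO (binom_prod (\<alpha> - eps k) \<beta> * shuffle_sign u v) (trunc_mon \<delta> (u \<union> v)))"
    using assms by (simp add: pd_mon_even omult_mon_eq A_minus_eps minus_eps_add \<delta>_def)
  have R2: "mon (\<alpha>, u) \<odot> \<partial> k (mon (\<beta>, v)) =
      (if \<beta> k = 0 then 0 else scaleO (binom_prod \<alpha> (\<beta> - eps k) * shuffle_sign u v) (trunc_mon \<delta> (u \<union> v)))"
    using assms by (simp add: pd_mon_even omult_mon_eq A_minus_eps add_minus_eps \<delta>_def)
  show ?thesis
  proof (cases "\<delta> \<in> A \<and> 0 < \<alpha> k + \<beta> k")
    case True
    have "\<partial> k (mon (\<alpha>, u) \<odot> mon (\<beta>, v)) =
      scaleO ((if \<alpha> + \<beta> \<in> A then binom_prod \<alpha> \<beta> else 0) * shuffle_sign u v) (trunc_mon \<delta> (u \<union> v))"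
      unfolding L using True by simp
    also have "\<dots> = \<partial> k (mon (\<alpha>, u)) \<odot> mon (\<beta>, v) + mon (\<alpha>, u) \<odot> \<partial> k (mon (\<beta>, v))"
      unfolding R1 R2 using True
      by (subst binom_prod_pascal[OF assms(1,2,5)]) (auto simp: \<delta>_def algebra_simps salg.scale_left_distrib)
    finally show ?thesis .
  next
    case False
    then show ?thesis
      unfolding L R1 R2 by (auto simp: trunc_mon_def)
  qed
qed

text \<open>
  The signs in the Leibniz rule for a left derivative of $x^u x^v$.  If \<open>k\<close> lies in both \<open>u\<close> and
  \<open>v\<close>, the product vanishes, and the two terms on the right have opposite signs.
\<close>

lemma shuffle_sign_leibniz:
  assumes fin: "finite u" "finite v"
  shows "(if k \<in> u \<or> k \<in> v then (-1) ^ card {j \<in> u \<union> v. j < k} * shuffle_sign u v else 0) =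
    (if k \<in> u then (-1) ^ card {j \<in> u. j < k} * shuffle_sign (u - {k}) v else 0) +
    (-1) ^ card u * (if k \<in> v then (-1) ^ card {j \<in> v. j < k} * shuffle_sign u (v - {k}) else 0)"
proof -
  consider "k \<notin> u" "k \<notin> v" | "k \<in> u" "k \<notin> v" | "k \<notin> u" "k \<in> v" | "k \<in> u" "k \<in> v"
    by blast
  then show ?thesis
  proof cases
    case 2
    then have "(u - {k}) \<inter> v = u \<inter> v" by auto
    then show ?thesis
      using 2 fin inversions_remove_left[OF fin, of k]
      by (cases "u \<inter> v = {}") (simp_all add: shuffle_sign_def card_below_Un minus_one_power_iff del: Un_iff)
  next
    case 3
    have card_u: "card u = card {j \<in> u. j < k} + card {j \<in> u. k < j}"
      using 3 card_below_above[OF fin(1), of k] by simp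
    have "(-1) ^ card {j \<in> u \<union> v. j < k} * (-1) ^ inversions u v =
        (-1) ^ card u * ((-1) ^ card {j \<in> v. j < k} * (-1) ^ inversions u (v - {k}) :: 'a)"
      if "u \<inter> v = {}"
      unfolding card_below_Un[OF fin that] inversions_remove_right[OF fin 3(2)] card_u
      by (simp only: power_add mult_ac)
    moreover have "u \<inter> (v - {k}) = u \<inter> v" using 3 by auto
    ultimately show ?thesis
      using 3 by (cases "u \<inter> v = {}") (simp_all add: shuffle_sign_def)
  next
    case 4
    have "(u - {k}) \<inter> v = u \<inter> (v - {k})" by auto
    moreover have "card u = Suc (card {j \<in> u. j < k} + card {j \<in> u. k < j})"
      using 4 card_below_above[OF fin(1), of k] fin card_Suc_Diff1[of u k] by simp
    moreover have "inversions (u - {k}) v = inversions (u - {k}) (v - {k}) + card {j \<in> u. k < j}"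
    proof -
      have "{j \<in> u - {k}. k < j} = {j \<in> u. k < j}" by auto
      then show ?thesis using inversions_remove_right[of "u - {k}" v k] fin 4 by simp
    qed
    moreover have "inversions u (v - {k}) = inversions (u - {k}) (v - {k}) + card {j \<in> v. j < k}"
    proof -
      have "{j \<in> v - {k}. j < k} = {j \<in> v. j < k}" by auto
      then show ?thesis using inversions_remove_left[of u "v - {k}" k] fin 4 by simp
    qed
    moreover have "u \<inter> v \<noteq> {}" using 4 by auto
    ultimately show ?thesis
      using 4 by (cases "(u - {k}) \<inter> v = {}") (auto simp: shuffle_sign_def minus_one_power_iff)
  qed simp
qed

lemma leibniz_mon_odd:
  assumes "\<alpha> \<in> A" "\<beta> \<in> A" "u \<subseteq> Io" "v \<subseteq> Io" "k \<in> Io"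
  shows "\<partial> k (mon (\<alpha>, u) \<odot> mon (\<beta>, v)) =
    \<partial> k (mon (\<alpha>, u)) \<odot> mon (\<beta>, v) + scaleO ((-1) ^ card u) (mon (\<alpha>, u) \<odot> \<partial> k (mon (\<beta>, v)))"
proof -
  have fin: "finite u" "finite v" using assms finite_Io finite_subset by blast+
  have sub: "u \<union> v \<subseteq> Io" "u - {k} \<subseteq> Io" "v - {k} \<subseteq> Io" using assms by auto
  define w where "w = (if k \<in> u \<inter> v then u \<union> v else u \<union> v - {k})"
  have L: "\<partial> k (mon (\<alpha>, u) \<odot> mon (\<beta>, v)) = scaleO (binom_prod \<alpha> \<beta> *
      (if k \<in> u \<or> k \<in> v then (-1) ^ card {j \<in> u \<union> v. j < k} * shuffle_sign u v else 0)) (trunc_mon (\<alpha> + \<beta>) w)"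
  proof (cases "k \<in> u \<inter> v")
    case True
    then have "shuffle_sign u v = 0" by (auto simp: shuffle_sign_def)
    then show ?thesis using assms by (simp add: omult_mon_eq)
  next
    case False
    then show ?thesis
      using assms sub by (simp add: omult_mon_eq pd_scale trunc_mon_def pd_mon_odd mult.commute mult.left_commute w_def)
  qed
  have "u - {k} \<union> v = w" if "k \<in> u" using that by (auto simp: w_def)
  then have R1: "\<partial> k (mon (\<alpha>, u)) \<odot> mon (\<beta>, v) = scaleO (binom_prod \<alpha> \<beta> *
      (if k \<in> u then (-1) ^ card {j \<in> u. j < k} * shuffle_sign (u - {k}) v else 0)) (trunc_mon (\<alpha> + \<beta>) w)"
    using assms sub by (simp add: omult_mon_eq pd_mon_odd omult_scale_left mult.commute mult.left_commute)
  have "u \<union> (v - {k}) = w" if "k \<in> v" using that by (auto simp: w_def)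
  then have R2: "mon (\<alpha>, u) \<odot> \<partial> k (mon (\<beta>, v)) = scaleO (binom_prod \<alpha> \<beta> *
      (if k \<in> v then (-1) ^ card {j \<in> v. j < k} * shuffle_sign u (v - {k}) else 0)) (trunc_mon (\<alpha> + \<beta>) w)"
    using assms sub by (simp add: omult_mon_eq pd_mon_odd omult_scale_right mult.commute mult.left_commute)
  show ?thesis
    unfolding L R1 R2 shuffle_sign_leibniz[OF fin]
    by (simp only: distrib_left salg.scale_left_distrib salg.scale_scale mult.left_commute)
qed

section \<open>Superderivations of a supercommutative algebra\<close>

lemma has_parity_pd:
  assumes "has_parity e f" "k \<in> I"
  shows "has_parity (e + par k) (\<partial> k f)"
  using assms(1)
proof (induction rule: parity_induct)
  case (mon c a)
  obtain \<alpha> u where a: "a = (\<alpha>, u)" by (cases a)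
  have u: "finite u" "\<alpha> \<in> A" "u \<subseteq> Io" using mon a finite_subset[OF _ finite_Io] by (auto simp: Bas_eq)
  have "has_parity (e + par k) (\<partial> k (mon a))"
  proof (cases "k \<in> Ie")
    case True
    then show ?thesis using mon u
      by (auto simp: a pd_mon_even Bas_eq par_simps intro!: has_parity_mon A_minus_eps)
  next
    case False
    then have k: "k \<in> Io" using assms by (simp add: I_cases)
    have "card u = Suc (card (u - {k}))" if "k \<in> u"
      using that u by (metis card_Suc_Diff1)
    then show ?thesis using mon u k
      by (auto simp: a pd_mon_odd Bas_eq par_simps intro!: has_parity_mon has_parity_scale)
  qed
  then show ?case by (simp add: pd_scale has_parity_scale)
qed (simp_all only: pd_add pd_zero has_parity_add has_parity_zero)

lemma has_parity_omult:
  assumes "has_parity e f" "has_parity e' g"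
  shows "has_parity (e + e') (f \<odot> g)"
  using assms(1)
proof (induction rule: parity_induct)
  case (mon c a)
  from assms(2) show ?case
  proof (induction rule: parity_induct)
    case (mon c' b)
    obtain \<alpha> u \<beta> v where ab: "a = (\<alpha>, u)" "b = (\<beta>, v)" by (cases a; cases b)
    have u: "finite u" "\<alpha> \<in> A" "u \<subseteq> Io" "finite v" "\<beta> \<in> A" "v \<subseteq> Io"
      using mon \<open>a \<in> Bas\<close> ab finite_subset[OF _ finite_Io] by (auto simp: Bas_eq)
    have "has_parity (e + e') (mon a \<odot> mon b)"
    proof (cases "u \<inter> v = {}")
      case True
      then show ?thesis using u mon \<open>even (card (snd a) + e)\<close>
        by (auto simp: ab omult_mon_eq trunc_mon_def Bas_eq card_Un_disjoint
            intro!: has_parity_mon has_parity_scale)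
    next
      case False
      then show ?thesis using u by (simp add: ab omult_mon_eq shuffle_sign_def)
    qed
    then show ?case by (simp add: omult_scale_left omult_scale_right has_parity_scale)
  qed (simp_all only: omult_add_right omult_zero has_parity_add has_parity_zero)
qed (simp_all only: omult_add_left omult_zero has_parity_add has_parity_zero)

lemma leibniz:
  assumes "has_parity e f" "has_parity e' g" "k \<in> I"
  shows "\<partial> k (f \<odot> g) = \<partial> k f \<odot> g + scaleO ((-1) ^ (par k * e)) (f \<odot> \<partial> k g)"
  using assms(1)
proof (induction rule: parity_induct)
  case (add f f')
  then show ?case
    by (simp only: omult_add_left pd_add salg.scale_right_distrib add_ac)
next
  case (mon c a)
  from assms(2) show ?case
  proof (induction rule: parity_induct)
    case (add f f')
    then show ?case
      by (simp only: omult_add_right pd_add salg.scale_right_distrib add_ac)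
  next
    case (mon c' b)
    obtain \<alpha> u \<beta> v where ab: "a = (\<alpha>, u)" "b = (\<beta>, v)" by (cases a; cases b)
    have u: "\<alpha> \<in> A" "u \<subseteq> Io" "\<beta> \<in> A" "v \<subseteq> Io"
      using mon \<open>a \<in> Bas\<close> ab by (auto simp: Bas_eq)
    have e: "(-1) ^ e = ((-1) ^ card u :: 'a)"
      using \<open>even (card (snd a) + e)\<close> by (simp add: ab minus_one_power_iff)
    have "\<partial> k (mon a \<odot> mon b) = \<partial> k (mon a) \<odot> mon b + scaleO ((-1) ^ (par k * e)) (mon a \<odot> \<partial> k (mon b))"
    proof (cases "k \<in> Ie")
      case True
      then show ?thesis using u by (simp add: ab leibniz_mon_even par_simps)
    next
      case False
      then have "k \<in> Io" using assms by (simp add: I_cases)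
      then show ?thesis using u e by (simp add: ab leibniz_mon_odd par_simps)
    qed
    then show ?case
      by (simp only: omult_scale_left omult_scale_right pd_scale salg.scale_right_distrib
          salg.scale_scale mult_ac)
  qed (simp only: omult_zero pd_zero salg.scale_zero_right add_0)
qed (simp only: omult_zero pd_zero salg.scale_zero_right add_0)

lemma supercommute:
  assumes "has_parity e f" "has_parity e' g"
  shows "g \<odot> f = scaleO ((-1) ^ (e * e')) (f \<odot> g)"
  using assms(1)
proof (induction rule: parity_induct)
  case (add f f')
  then show ?case
    by (simp only: omult_add_left omult_add_right salg.scale_right_distrib)
next
  case (mon c a)
  from assms(2) show ?case
  proof (induction rule: parity_induct)
    case (add f f')
    then show ?case
      by (simp only: omult_add_left omult_add_right salg.scale_right_distrib)
  next
    case (mon c' b)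
    obtain \<alpha> u \<beta> v where ab: "a = (\<alpha>, u)" "b = (\<beta>, v)" by (cases a; cases b)
    have u: "finite u" "\<alpha> \<in> A" "u \<subseteq> Io" "finite v" "\<beta> \<in> A" "v \<subseteq> Io"
      using mon \<open>a \<in> Bas\<close> ab finite_subset[OF _ finite_Io] by (auto simp: Bas_eq)
    have e: "(-1) ^ (e * e') = ((-1) ^ (card u * card v) :: 'a)"
      using \<open>even (card (snd a) + e)\<close> \<open>even (card (snd b) + e')\<close> by (simp add: ab minus_one_power_iff)
    have "mon b \<odot> mon a = scaleO ((-1) ^ (e * e')) (mon a \<odot> mon b)"
      using u unfolding e
      by (simp add: ab omult_mon_eq shuffle_sign_commute[of u v] binom_prod_commute[of \<beta>] Un_commute add.commute mult.left_commute)
    then show ?case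
      by (simp only: omult_scale_left omult_scale_right salg.scale_scale mult_ac)
  qed (simp only: omult_zero pd_zero salg.scale_zero_right add_0)
qed (simp only: omult_zero pd_zero salg.scale_zero_right add_0)

lemma pd_commute_mon:
  assumes "\<alpha> \<in> A" "u \<subseteq> Io" "i \<in> I" "k \<in> I" "i \<le> k"
  shows "\<partial> k (\<partial> i (mon (\<alpha>, u))) = scaleO ((-1) ^ (par k * par i)) (\<partial> i (\<partial> k (mon (\<alpha>, u))))"
proof -
  have fin: "finite u" using assms finite_subset[OF _ finite_Io] by blast
  have sub: "u - {x} \<subseteq> Io" for x using assms by auto
  have sw: "\<alpha> - eps i - eps k = \<alpha> - eps k - eps i" "u - {i} - {k} = u - {k} - {i}"
    by (auto simp: fun_eq_iff)
  have eps_apply: "eps x j = (if j = x then 1 else 0)" for x j by (simp add: eps_def)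
  note eq = pd_mon_even pd_mon_odd par_simps A_minus_eps sub assms(1,2) pd_scale
  consider "i \<in> Ie" "k \<in> Ie" | "i \<in> Ie" "k \<in> Io" | "i \<in> Io" "k \<in> Ie" | "i \<in> Io" "k \<in> Io"
    using assms by (auto simp: I_cases)
  then show ?thesis
  proof cases
    case 1
    then show ?thesis by (cases "i = k") (auto simp: eq sw eps_apply)
  next
    case 2
    then show ?thesis by (auto simp: eq)
  next
    case 3
    then show ?thesis by (auto simp: eq)
  next
    case 4
    show ?thesis
    proof (cases "i = k")
      case True
      then show ?thesis using 4 by (simp add: eq)
    next
      case False
      then have "i < k" using assms by simp
      have two: "\<partial> y (\<partial> x (mon (\<alpha>, u))) = (if x \<in> u \<and> y \<in> u then
          scaleO ((-1) ^ card {j \<in> u. j < x} * (-1) ^ card {j \<in> u - {x}. j < y}) (mon (\<alpha>, u - {x} - {y})) else 0)"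
        if "x \<in> Io" "y \<in> Io" "x \<noteq> y" for x y
        using that by (simp add: eq del: Diff_iff) (simp add: eq)
      show ?thesis
      proof (cases "i \<in> u \<and> k \<in> u")
        case True
        then have "card {j \<in> u. j < k} = Suc (card {j \<in> u - {i}. j < k})"
          "card {j \<in> u. j < i} = card {j \<in> u - {k}. j < i}"
          using \<open>i < k\<close> card_below_remove[OF fin, of i k] card_below_remove[OF fin, of k i] by simp_all
        then show ?thesis
          unfolding two[OF 4 \<open>i \<noteq> k\<close>] two[OF 4(2,1) \<open>i \<noteq> k\<close>[symmetric]] sw(2)
          using 4 True by (simp only: par_simps salg.scale_scale power_Suc power_0 mult_1_right mult_ac
            minus_mult_minus power_one_right mult_1_left mult_minus_left mult_minus_right if_True simp_thms minus_minus)
      qed (auto simp: two 4 \<open>i \<noteq> k\<close> \<open>i \<noteq> k\<close>[symmetric])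
    qed
  qed
qed

lemma pd_commute:
  assumes "has_parity e f" "i \<in> I" "k \<in> I"
  shows "\<partial> k (\<partial> i f) = scaleO ((-1) ^ (par k * par i)) (\<partial> i (\<partial> k f))"
  using assms(1)
proof (induction rule: parity_induct)
  case (add f g)
  then show ?case by (simp only: pd_add salg.scale_right_distrib)
next
  case (mon c a)
  obtain \<alpha> u where a: "a = (\<alpha>, u)" by (cases a)
  have u: "\<alpha> \<in> A" "u \<subseteq> Io" using mon a by (auto simp: Bas_eq)
  have "\<partial> k (\<partial> i (mon a)) = scaleO ((-1) ^ (par k * par i)) (\<partial> i (\<partial> k (mon a)))"
  proof (cases "i \<le> k")
    case True
    then show ?thesis unfolding a by (intro pd_commute_mon u assms)
  next
    case False
    then have "\<partial> i (\<partial> k (mon a)) = scaleO ((-1) ^ (par i * par k)) (\<partial> k (\<partial> i (mon a)))"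
      unfolding a by (intro pd_commute_mon u assms) auto
    then show ?thesis by (simp add: mult.commute flip: power_add mult_2)
  qed
  then show ?case
    by (simp only: pd_scale salg.scale_scale mult.commute)
qed (simp only: pd_zero salg.scale_zero_right)

section \<open>Hamiltonian fields and the Poisson bracket\<close>

lemma D_add: "D (f + g) = D f + D g"
  by (simp add: DH_def witt.scale_left_distrib sum.distrib)

lemma D_scale: "D (scaleO c f) = scaleW c (D f)"
  by (simp add: DH_def witt.scale_sum_right scaleO_apply)

lemma D_zero: "D 0 = 0"
  by (simp add: DH_def)

lemma D_mon: "a \<in> Bas \<Longrightarrow> D (mon a) = mono_DH p m n t a"
proof -
  assume a: "a \<in> Bas"
  have "scaleW (mon a b :: 'a) X = (if b = a then X else 0)" for b X
    by (simp add: mon_def)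
  then show ?thesis using a by (simp add: DH_def sum.delta)
qed

text \<open>
  On even monomials the parity signs in the Hamiltonian map disappear, and only $\tau$ is left.
\<close>

lemma mono_DH_apply:
  assumes "a \<in> Bas" "even (card (snd a))"
  shows "mono_DH p m n t a j = (if j \<in> I then scaleO (sg (dual j)) (\<partial> (dual j) (mon a)) else 0)"
proof -
  have "mono_DH p m n t a j =
      (\<Sum>i\<in>I. if j = dual i then scaleO (sg i) (\<partial> i (mon a)) else 0)"
    unfolding mono_DH_def using assms
    by (intro trans[OF sum_apply] sum.cong) (auto simp: scaleW_apply dterm_apply)
  also have "\<dots> = (\<Sum>i\<in>I. if i = dual j \<and> j \<in> I then scaleO (sg i) (\<partial> i (mon a)) else 0)"
    by (intro sum.cong refl) (auto simp: dual_dual dual_I)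
  also have "\<dots> = (if j \<in> I then scaleO (sg (dual j)) (\<partial> (dual j) (mon a)) else 0)"
    by (auto simp: sum.delta dual_I)
  finally show ?thesis .
qed

lemma D_apply:
  assumes "has_parity 0 f"
  shows "D f j = (if j \<in> I then scaleO (sg (dual j)) (\<partial> (dual j) f) else 0)"
  using assms
proof (induction rule: parity_induct)
  case (add f g)
  have "D (f + g) j = D f j + D g j"
    by (subst D_add) (rule plus_fun_apply)
  with add show ?case
    by (cases "j \<in> I") (simp_all only: pd_add salg.scale_right_distrib if_True if_False add_0_left)
next
  case (mon c a)
  then show ?case
    by (simp add: D_scale D_mon scaleW_apply mono_DH_apply pd_scale mult.commute)
next
  case zero
  have "D 0 j = 0"
    by (subst D_zero) (rule zero_fun_apply)
  then show ?case
    by (simp only: pd_zero salg.scale_zero_right if_cancel)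
qed

lemma alg_sum_expand:
  assumes "f \<in> alg" "g \<in> alg"
  shows "f \<odot> \<partial> i g = (\<Sum>a\<in>Bas. \<Sum>b\<in>Bas. scaleO (f a * g b) (mon a \<odot> \<partial> i (mon b)))"
proof -
  have "f \<odot> \<partial> i g = (\<Sum>a\<in>Bas. scaleO (f a) (mon a)) \<odot> \<partial> i (\<Sum>b\<in>Bas. scaleO (g b) (mon b))"
    using alg_expand[OF assms(1)] alg_expand[OF assms(2)] by (simp only: flip:)
  also have "\<dots> = (\<Sum>a\<in>Bas. \<Sum>b\<in>Bas. scaleO (f a * g b) (mon a \<odot> \<partial> i (mon b)))"
    by (simp only: omult_sum_left omult_sum_right pd_sum pd_scale omult_scale_left omult_scale_right
        salg.scale_sum_right salg.scale_scale mult.commute[of "g _"]) (rule sum.swap)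
  finally show ?thesis .
qed

text \<open>
  For fields of total parity zero, all signs in the bracket are positive and it is the usual commutator
  of vector fields, read off one coefficient at a time.
\<close>

lemma bracket_even:
  assumes X: "\<And>i. i \<in> I \<Longrightarrow> has_parity (par i) (X i)" and Z: "\<And>i. i \<in> I \<Longrightarrow> has_parity (par i) (Z i)"
  shows "brk X Z l =
    (if l \<in> I then \<Sum>i\<in>I. X i \<odot> \<partial> i (Z l) - Z i \<odot> \<partial> i (X l) else 0)"
proof -
  have part: "(\<Sum>a\<in>Bas. \<Sum>b\<in>Bas. scaleW (X i a * Z j b) (mono_bracket p m n t a i b j)) =
      dterm (X i \<odot> \<partial> i (Z j)) j - dterm (Z j \<odot> \<partial> j (X i)) i" if ij: "i \<in> I" "j \<in> I" for i j
  proof -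
    have sgn: "scaleW (X i a * Z j b) (mono_bracket p m n t a i b j) =
        dterm (scaleO (X i a * Z j b) (mon a \<odot> \<partial> i (mon b))) j
        - dterm (scaleO (Z j b * X i a) (mon b \<odot> \<partial> j (mon a))) i" for a b
    proof (cases "X i a = 0")
      case True
      have "dterm (0 :: 'a salg) j = 0" for j by (simp add: dterm_def fun_eq_iff)
      then show ?thesis using True by simp
    next
      case False
      then have "even (card (snd a) + par i)"
        using X[OF ij(1)] unfolding has_parity_def by blast
      then show ?thesis
        by (simp add: mono_bracket_def dterm_scale witt.scale_right_diff_distrib mult.commute)
    qed
    have "(\<Sum>a\<in>Bas. \<Sum>b\<in>Bas. scaleW (X i a * Z j b) (mono_bracket p m n t a i b j)) =
        dterm (\<Sum>a\<in>Bas. \<Sum>b\<in>Bas. scaleO (X i a * Z j b) (mon a \<odot> \<partial> i (mon b))) j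
        - dterm (\<Sum>a\<in>Bas. \<Sum>b\<in>Bas. scaleO (Z j b * X i a) (mon b \<odot> \<partial> j (mon a))) i"
      by (simp only: sgn sum_subtractf dterm_sum)
    also have "\<dots> = dterm (X i \<odot> \<partial> i (Z j)) j - dterm (Z j \<odot> \<partial> j (X i)) i"
      by (subst (2) sum.swap)
        (simp only: alg_sum_expand has_parity_alg[OF X[OF ij(1)]] has_parity_alg[OF Z[OF ij(2)]])
    finally show ?thesis .
  qed
  have "brk X Z = (\<Sum>i\<in>I. \<Sum>j\<in>I. dterm (X i \<odot> \<partial> i (Z j)) j - dterm (Z j \<odot> \<partial> j (X i)) i)"
    unfolding bracket_def by (intro sum.cong refl part)
  then have "brk X Z l = (\<Sum>i\<in>I. \<Sum>j\<in>I. (dterm (X i \<odot> \<partial> i (Z j)) j - dterm (Z j \<odot> \<partial> j (X i)) i) l)"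
    by (simp only: sum_apply[where x = l])
  also have "\<dots> = (\<Sum>i\<in>I. \<Sum>j\<in>I. if l = j then X i \<odot> \<partial> i (Z j) else 0)
      - (\<Sum>i\<in>I. \<Sum>j\<in>I. if l = i then Z j \<odot> \<partial> j (X i) else 0)"
    by (simp only: minus_apply dterm_apply sum_subtractf)
  also have "(\<Sum>i\<in>I. \<Sum>j\<in>I. if l = i then Z j \<odot> \<partial> j (X i) else 0)
      = (\<Sum>j\<in>I. \<Sum>i\<in>I. if l = i then Z j \<odot> \<partial> j (X i) else 0)"
    by (rule sum.swap)
  finally show ?thesis
    by (cases "l \<in> I") (simp_all only: sum.delta' finite_I if_True if_False sum.neutral_const
        diff_self sum_subtractf)
qed

definition poisson :: "'a salg \<Rightarrow> 'a salg \<Rightarrow> 'a salg" where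
  "poisson f g = (\<Sum>i\<in>I. scaleO (sg i) (\<partial> i f \<odot> \<partial> (dual i) g))"

lemma has_parity_cong: "has_parity e f \<Longrightarrow> even (e + e') \<Longrightarrow> has_parity e' f"
  by (auto simp: has_parity_def)

lemma has_parity_poisson:
  assumes "has_parity 0 f" "has_parity 0 g"
  shows "has_parity 0 (poisson f g)"
  unfolding poisson_def
proof (intro has_parity_sum has_parity_scale)
  fix i assume i: "i \<in> I"
  show "has_parity 0 (\<partial> i f \<odot> \<partial> (dual i) g)"
    by (rule has_parity_cong[OF has_parity_omult[OF has_parity_pd[OF assms(1) i] has_parity_pd[OF assms(2) dual_I[OF i]]]])
      (simp add: par_dual i)
qed

lemma D_parity:
  assumes "has_parity 0 f" "i \<in> I"
  shows "has_parity (par i) (D f i)"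
  using has_parity_pd[OF assms(1) dual_I[OF assms(2)]] assms
  by (simp add: D_apply has_parity_scale par_dual)

text \<open>
  Compare the coefficients of $\partial_l$, with \<open>k = dual l\<close>.  Up to the common factor $\tau(k)$ they
  are, on the left,
  $\sum_i \tau(i)(\partial_i f\, \partial_{i'}\partial_k g - \partial_i g\, \partial_{i'}\partial_k f)$,
  and on the right $\partial_k$ applied to $\{f, g\}$.  The Leibniz rule produces the first family of terms
  directly; the second family becomes $\partial_k\partial_i f\, \partial_{i'} g$ after exchanging
  \<open>i\<close> with its dual, the sign of \<open>sg_dual\<close> cancelling the one from supercommutativity.
\<close>

lemma bracket_D:
  assumes f: "has_parity 0 f" and g: "has_parity 0 g"
  shows "brk (D f) (D g) = D (poisson f g)"
proof
  fix l
  show "brk (D f) (D g) l = D (poisson f g) l"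
  proof (cases "l \<in> I")
    case False
    then show ?thesis
      by (simp add: bracket_even[OF D_parity[OF f] D_parity[OF g]] D_apply has_parity_poisson f g)
  next
    case l: True
    define k where "k = dual l"
    have k: "k \<in> I" using l by (simp add: k_def dual_I)
    have Pf: "has_parity (par i) (\<partial> i f)" and Pg: "has_parity (par i) (\<partial> i g)" if "i \<in> I" for i
      using has_parity_pd[OF f that] has_parity_pd[OF g that] by simp_all
    define T where "T i = \<partial> i f \<odot> \<partial> (dual i) (\<partial> k g)" for i
    define T' where "T' i = \<partial> i g \<odot> \<partial> (dual i) (\<partial> k f)" for i
    have "brk (D f) (D g) l = (\<Sum>i\<in>I. D f i \<odot> \<partial> i (D g l) - D g i \<odot> \<partial> i (D f l))"
      using l by (simp add: bracket_even[OF D_parity[OF f] D_parity[OF g]])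
    also have "\<dots> = (\<Sum>i\<in>I. scaleO (sg k) (scaleO (sg (dual i)) (T (dual i) - T' (dual i))))"
      using l by (intro sum.cong refl)
        (simp add: D_apply f g T_def T'_def dual_dual k_def pd_scale omult_scale_left omult_scale_right
          salg.scale_right_diff_distrib mult.commute)
    also have "\<dots> = (\<Sum>i\<in>I. scaleO (sg k) (scaleO (sg i) (T i - T' i)))"
      by (rule sum_dual)
    also have "\<dots> = scaleO (sg k) ((\<Sum>i\<in>I. scaleO (sg i) (T i)) - (\<Sum>i\<in>I. scaleO (sg i) (T' i)))"
      by (simp only: salg.scale_right_diff_distrib sum_subtractf salg.scale_sum_right)
    also have "(\<Sum>i\<in>I. scaleO (sg i) (T' i)) = - (\<Sum>i\<in>I. scaleO (sg i) (\<partial> k (\<partial> i f) \<odot> \<partial> (dual i) g))"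
    proof -
      have T': "scaleO (sg i) (T' i) = - scaleO (sg (dual i)) (\<partial> k (\<partial> (dual i) f) \<odot> \<partial> i g)"
        if i: "i \<in> I" for i
      proof -
        let ?s = "(-1) ^ par i :: 'a"
        have "T' i = scaleO ((-1) ^ ((par i + par k) * par i)) (\<partial> (dual i) (\<partial> k f) \<odot> \<partial> i g)"
          unfolding T'_def
          by (rule supercommute) (use has_parity_pd[OF Pf[OF k] dual_I[OF i]] Pg[OF i] in
            \<open>simp_all add: par_dual i add.commute\<close>)
        also have "\<partial> (dual i) (\<partial> k f) = scaleO ((-1) ^ (par i * par k)) (\<partial> k (\<partial> (dual i) f))"
          using pd_commute[OF f k dual_I[OF i]] by (simp add: par_dual i)
        finally have "T' i = scaleO ((-1) ^ ((par i + par k) * par i) * (-1) ^ (par i * par k))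
            (\<partial> k (\<partial> (dual i) f) \<odot> \<partial> i g)"
          by (simp only: omult_scale_left salg.scale_scale)
        also have "(-1) ^ ((par i + par k) * par i) * (-1) ^ (par i * par k) = ?s"
          by (simp add: minus_one_power_iff)
        finally show ?thesis
          by (simp add: sg_dual i mult.commute)
      qed
      have "(\<Sum>i\<in>I. scaleO (sg i) (T' i)) = (\<Sum>i\<in>I. - scaleO (sg (dual i)) (\<partial> k (\<partial> (dual i) f) \<odot> \<partial> (dual (dual i)) g))"
        by (intro sum.cong refl) (simp add: T' dual_dual)
      also have "\<dots> = (\<Sum>i\<in>I. - scaleO (sg i) (\<partial> k (\<partial> i f) \<odot> \<partial> (dual i) g))"
        by (rule sum_dual)
      finally show ?thesis by (simp only: sum_negf)
    qed
    also have "(\<Sum>i\<in>I. scaleO (sg i) (T i)) - - (\<Sum>i\<in>I. scaleO (sg i) (\<partial> k (\<partial> i f) \<odot> \<partial> (dual i) g)) =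
        (\<Sum>i\<in>I. scaleO (sg i) (\<partial> k (\<partial> i f \<odot> \<partial> (dual i) g)))"
    proof -
      have "\<partial> k (\<partial> i f \<odot> \<partial> (dual i) g) = \<partial> k (\<partial> i f) \<odot> \<partial> (dual i) g + T i" if i: "i \<in> I" for i
      proof -
        have "T i = scaleO ((-1) ^ (par k * par i)) (\<partial> i f \<odot> \<partial> k (\<partial> (dual i) g))"
          unfolding T_def using pd_commute[OF g k dual_I[OF i]]
          by (simp add: par_dual i omult_scale_right mult.commute)
        then show ?thesis
          by (simp only: leibniz[OF Pf[OF i] Pg[OF dual_I[OF i]] k])
      qed
      then show ?thesis
        by (simp add: salg.scale_right_distrib sum.distrib add.commute cong: sum.cong)
    qed
    also have "scaleO (sg k) \<dots> = D (poisson f g) l"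
      using l by (subst D_apply[OF has_parity_poisson[OF f g]])
        (simp only: poisson_def pd_sum pd_scale k_def if_True)
    finally show ?thesis .
  qed
qed

section \<open>Closure under the bracket\<close>

text \<open>
  Describing the span by vanishing coefficients (\<open>NN_eq\<close>) turns closure under the bracket into a
  statement about two coefficients of the Poisson bracket.
\<close>

definition topless :: "'a salg set" where
  "topless = {f. has_parity 0 f \<and> f (\<pi>, Io) = 0 \<and> f (\<pi>, {}) = 0}"

lemma BB0_iff: "u \<in> BB0 m n \<longleftrightarrow> u \<subseteq> Io \<and> even (card u)"
  using Bas_eq by (auto simp: BB0_def basis_def AA_def times_eq_iff)

lemma D_sum: "D (\<Sum>a\<in>S. F a) = (\<Sum>a\<in>S. D (F a))"
  by (induction S rule: infinite_finite_induct) (simp_all only: D_add D_zero sum.empty sum.insert sum.infinite not_False_eq_True)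

lemma NN_eq: "NN p m n t = D ` topless"
proof
  have "witt.subspace (D ` topless)"
    unfolding witt.subspace_def
  proof (intro conjI ballI allI)
    have "0 \<in> topless" by (simp add: topless_def)
    then have "D 0 \<in> D ` topless" by (rule imageI)
    then show "0 \<in> D ` topless" by (simp only: D_zero)
  next
    fix X Z assume "X \<in> D ` topless" "Z \<in> D ` topless"
    then obtain f g where fg: "f \<in> topless" "g \<in> topless" "X = D f" "Z = D g" by blast
    then have "f + g \<in> topless" by (simp add: topless_def has_parity_add)
    then show "X + Z \<in> D ` topless" using fg D_add by (metis imageI)
  next
    fix c X assume "X \<in> D ` topless"
    then obtain f where f: "f \<in> topless" "X = D f" by blast
    then have "scaleO c f \<in> topless" by (simp add: topless_def has_parity_scale scaleO_apply)
    then show "scaleW c X \<in> D ` topless" using f D_scale by (metis imageI)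
  qed
  moreover have "mon (\<alpha>, u) \<in> topless"
    if "\<alpha> \<in> A" "u \<in> BB0 m n" "(\<alpha>, u) \<noteq> (\<pi>, Io)" "(\<alpha>, u) \<noteq> (\<pi>, {})" for \<alpha> u
  proof -
    have "has_parity 0 (mon (\<alpha>, u) :: 'a salg)"
      using that by (intro has_parity_mon) (auto simp: BB0_iff Bas_eq)
    moreover have "mon (\<alpha>, u) (\<pi>, Io) = (0 :: 'a)" "mon (\<alpha>, u) (\<pi>, {}) = (0 :: 'a)"
      unfolding mon_def using that(3,4) by (simp_all only: if_False eq_commute[of _ "(\<alpha>, u)"])
    ultimately show ?thesis by (simp add: topless_def)
  qed
  ultimately show "NN p m n t \<subseteq> D ` topless"
    unfolding NN_def by (intro witt.span_minimal) blast+
next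
  show "D ` topless \<subseteq> NN p m n t"
  proof
    fix X assume "X \<in> D ` topless"
    then obtain f where f: "f \<in> topless" "X = D f" by blast
    have "f \<in> alg" using f has_parity_alg by (auto simp: topless_def)
    then have "X = (\<Sum>a\<in>Bas. scaleW (f a) (D (mon a)))"
      unfolding f(2) D_scale[symmetric] D_sum[symmetric] by (intro arg_cong[of _ _ D] alg_expand)
    also have "\<dots> \<in> NN p m n t"
      unfolding NN_def
    proof (intro witt.span_sum)
      fix a assume a: "a \<in> Bas"
      obtain \<alpha> u where au: "a = (\<alpha>, u)" by (cases a)
      show "scaleW (f a) (D (mon a)) \<in> witt.span {D (mon (\<alpha>, u)) |\<alpha> u. \<alpha> \<in> A \<and> u \<in> BB0 m n \<and>
          (\<alpha>, u) \<noteq> (\<pi>, Io) \<and> (\<alpha>, u) \<noteq> (\<pi>, {})}"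
      proof (cases "f a = 0")
        case True
        then show ?thesis by (simp only: witt.scale_zero_left witt.span_zero)
      next
        case False
        then have "even (card u)"
          using f(1) au unfolding topless_def has_parity_def by fastforce
        moreover have "(\<alpha>, u) \<noteq> (\<pi>, Io)" "(\<alpha>, u) \<noteq> (\<pi>, {})"
          using False f(1) au by (auto simp: topless_def)
        moreover have "\<alpha> \<in> A" "u \<subseteq> Io" using a au by (auto simp: Bas_eq)
        ultimately show ?thesis
          unfolding au by (intro witt.span_scale witt.span_base) (auto simp: BB0_iff)
      qed
    qed
    finally show "X \<in> NN p m n t" .
  qed
qed

lemma pd_even_top:
  assumes "i \<in> Ie"
  shows "\<partial> i f (\<pi>, w) = 0"
proof -
  have "scaleO (f a) (mono_partial m i a) (\<pi>, w) = 0" if a: "a \<in> Bas" for a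
  proof -
    obtain \<alpha> u where au: "a = (\<alpha>, u)" by (cases a)
    have "\<alpha> i \<le> \<pi> i" using a au by (simp add: Bas_eq in_A_iff)
    moreover have "(\<alpha> - eps i) i = \<alpha> i - 1" by (simp add: eps_def)
    ultimately have "\<alpha> i \<noteq> 0 \<Longrightarrow> \<pi> \<noteq> \<alpha> - eps i" by force
    then show ?thesis using assms by (simp add: au mono_partial_def scaleO_apply mon_def)
  qed
  then show ?thesis
    unfolding partial_def sum_apply by (intro sum.neutral) blast
qed

lemma pd_odd_support:
  assumes "i \<in> Io" "\<partial> i f (\<gamma>, w) \<noteq> 0"
  shows "i \<notin> w \<and> f (\<gamma>, insert i w) \<noteq> 0"
proof -
  have "(\<Sum>a\<in>Bas. scaleO (f a) (mono_partial m i a) (\<gamma>, w)) \<noteq> 0"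
    using assms(2) by (simp add: partial_def sum_apply)
  then obtain a where a: "a \<in> Bas" "scaleO (f a) (mono_partial m i a) (\<gamma>, w) \<noteq> 0"
    by (meson sum.neutral)
  obtain \<alpha> u where au: "a = (\<alpha>, u)" by (cases a)
  have "i \<notin> Ie" using assms(1) Ie_Io_disjoint by blast
  then have "f (\<alpha>, u) \<noteq> 0" "i \<in> u" "\<gamma> = \<alpha>" "w = u - {i}"
    using a(2) by (auto simp: au mono_partial_def scaleO_apply mon_def split: if_splits)
  then show ?thesis by (auto simp: insert_absorb)
qed

lemma omult_support:
  assumes "(f \<odot> g) (\<gamma>, w) \<noteq> 0"
  obtains \<alpha> u \<beta> v where "f (\<alpha>, u) \<noteq> 0" "g (\<beta>, v) \<noteq> 0" "u \<inter> v = {}" "w = u \<union> v"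
proof -
  have "(\<Sum>a\<in>Bas. \<Sum>b\<in>Bas. scaleO (f a * g b) (mono_mult p m t a b) (\<gamma>, w)) \<noteq> 0"
    using assms by (simp add: omult_def sum_apply)
  then obtain a where "(\<Sum>b\<in>Bas. scaleO (f a * g b) (mono_mult p m t a b) (\<gamma>, w)) \<noteq> 0"
    by (meson sum.neutral)
  then obtain b where ab: "scaleO (f a * g b) (mono_mult p m t a b) (\<gamma>, w) \<noteq> 0"
    by (meson sum.neutral)
  obtain \<alpha> u \<beta> v where "a = (\<alpha>, u)" "b = (\<beta>, v)" by (cases a; cases b)
  then show ?thesis
    using ab that by (auto simp: mono_mult_def scaleO_apply mon_def split: if_splits)
qed

lemma two_neq_0: "(2 :: 'a) \<noteq> 0"
proof
  assume "(2 :: 'a) = 0"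
  then have "of_nat 2 = (0 :: 'a)" by simp
  then have "p dvd 2" using char of_nat_eq_0_iff_char_dvd by blast
  then show False using p_gt by (auto dest: dvd_imp_le)
qed

text \<open>
  The terms at \<open>i\<close> and \<open>dual i\<close> have opposite coefficients and commuting derivatives, so the sum is
  its own negative; the characteristic is not two.
\<close>

lemma laplacian_zero:
  assumes g: "has_parity 0 g"
  shows "(\<Sum>i\<in>Ie. scaleO (sg i) (\<partial> i (\<partial> (dual i) g))) = 0" (is "?S = 0")
proof -
  have bij: "bij_betw dual Ie Ie"
    by (rule bij_betw_byWitness[where f' = dual]) (auto simp: dual_Ie dual_dual I_cases)
  have "?S = (\<Sum>i\<in>Ie. scaleO (sg (dual i)) (\<partial> (dual i) (\<partial> (dual (dual i)) g)))"
    by (rule sum.reindex_bij_betw[OF bij, symmetric])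
  also have "\<dots> = (\<Sum>i\<in>Ie. - scaleO (sg i) (\<partial> i (\<partial> (dual i) g)))"
  proof (intro sum.cong refl)
    fix i assume i: "i \<in> Ie"
    then have iI: "i \<in> I" "dual i \<in> I" by (simp_all add: I_cases dual_Ie)
    have "\<partial> (dual i) (\<partial> i g) = \<partial> i (\<partial> (dual i) g)"
      using pd_commute[OF g iI] i by (simp add: par_simps dual_Ie)
    then show "scaleO (sg (dual i)) (\<partial> (dual i) (\<partial> (dual (dual i)) g)) = - scaleO (sg i) (\<partial> i (\<partial> (dual i) g))"
      by (simp add: dual_dual iI sg_dual par_simps i)
  qed
  also have "\<dots> = - ?S" by (rule sum_negf)
  finally have S: "?S = - ?S" .
  show ?thesis
  proof
    fix x
    have "?S x = - ?S x" using fun_cong[OF S, of x] by (simp only: uminus_apply)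
    then have "2 * ?S x = 0" by (simp only: mult_2 add_eq_0_iff)
    then show "?S x = 0 x" using two_neq_0 by simp
  qed
qed

text \<open>
  The even indices contribute a divergence, the odd ones products of odd elements free of $x_i$.
\<close>

lemma poisson_top:
  assumes f: "has_parity 0 f" and g: "has_parity 0 g" and w: "w = {} \<or> w = Io"
  shows "poisson f g (\<pi>, w) = 0"
proof -
  have I_un: "I = Ie \<union> Io" "Ie \<inter> Io = {}" using Ie_Io_disjoint by (auto simp: I_cases)
  have even_part: "(\<Sum>i\<in>Ie. scaleO (sg i) (\<partial> i f \<odot> \<partial> (dual i) g)) (\<pi>, w) = 0"
  proof -
    have "scaleO (sg i) (\<partial> i f \<odot> \<partial> (dual i) g) = scaleO (sg i) (\<partial> i (f \<odot> \<partial> (dual i) g))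
        - f \<odot> scaleO (sg i) (\<partial> i (\<partial> (dual i) g))" if i: "i \<in> Ie" for i
    proof -
      have iI: "i \<in> I" "dual i \<in> I" using i by (simp_all add: I_cases dual_Ie)
      show ?thesis
        using leibniz[OF f has_parity_pd[OF g iI(2)] iI(1)] i
        by (simp add: par_simps omult_scale_right salg.scale_right_distrib)
    qed
    then have "(\<Sum>i\<in>Ie. scaleO (sg i) (\<partial> i f \<odot> \<partial> (dual i) g)) =
        (\<Sum>i\<in>Ie. scaleO (sg i) (\<partial> i (f \<odot> \<partial> (dual i) g)))
        - f \<odot> (\<Sum>i\<in>Ie. scaleO (sg i) (\<partial> i (\<partial> (dual i) g)))"
      by (simp add: sum_subtractf omult_sum_right)
    then have "(\<Sum>i\<in>Ie. scaleO (sg i) (\<partial> i f \<odot> \<partial> (dual i) g)) =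
        (\<Sum>i\<in>Ie. scaleO (sg i) (\<partial> i (f \<odot> \<partial> (dual i) g)))"
      by (simp only: laplacian_zero[OF g] omult_zero diff_zero)
    then show ?thesis
      by (simp add: sum_apply scaleO_apply pd_even_top)
  qed
  have odd_part: "(\<partial> i f \<odot> \<partial> (dual i) g) (\<pi>, w) = 0" if i: "i \<in> Io" for i
  proof (rule ccontr)
    assume "(\<partial> i f \<odot> \<partial> (dual i) g) (\<pi>, w) \<noteq> 0"
    then obtain \<alpha> u \<beta> v where nz: "\<partial> i f (\<alpha>, u) \<noteq> 0" "\<partial> i g (\<beta>, v) \<noteq> 0" "w = u \<union> v"
      using omult_support dual_Io[OF i] by metis
    then have "i \<notin> w" "f (\<alpha>, insert i u) \<noteq> 0"
      using pd_odd_support[OF i] by auto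
    then have "w = {}" "f (\<alpha>, {i}) \<noteq> 0" using w i nz(3) by auto
    then show False using f unfolding has_parity_def by fastforce
  qed
  have "poisson f g (\<pi>, w) = (\<Sum>i\<in>Ie. scaleO (sg i) (\<partial> i f \<odot> \<partial> (dual i) g)) (\<pi>, w)
      + (\<Sum>i\<in>Io. scaleO (sg i) (\<partial> i f \<odot> \<partial> (dual i) g)) (\<pi>, w)"
    unfolding poisson_def I_un(1) by (subst sum.union_disjoint) (simp_all add: I_un)
  also have "\<dots> = 0"
    unfolding even_part by (simp add: sum_apply scaleO_apply odd_part)
  finally show ?thesis .
qed

lemma lie_subalgebra_NN: "lie_subalgebra p m n t (NN p m n t :: 'a witt set)"
  unfolding lie_subalgebra_def
proof (intro conjI ballI)
  show "NN p m n t \<subseteq> (WW p m n t :: 'a witt set)"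
  proof
    fix X assume "X \<in> (NN p m n t :: 'a witt set)"
    then obtain f where f: "has_parity 0 f" "X = D f" by (auto simp: NN_eq topless_def)
    show "X \<in> WW p m n t"
      unfolding WW_def f(2)
      using D_parity[OF f(1)] has_parity_alg D_apply[OF f(1)] by auto
  qed
  show "witt.subspace (NN p m n t :: 'a witt set)"
    unfolding NN_def by (rule witt.subspace_span)
  fix X Z assume "X \<in> (NN p m n t :: 'a witt set)" "Z \<in> (NN p m n t :: 'a witt set)"
  then obtain f g where fg: "has_parity 0 f" "has_parity 0 g" "X = D f" "Z = D g"
    by (auto simp: NN_eq topless_def)
  then have "poisson f g \<in> topless"
    by (simp add: topless_def has_parity_poisson poisson_top)
  then show "brk X Z \<in> NN p m n t"
    by (simp add: fg bracket_D NN_eq)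
qed

lemma eps_apply: "eps i j = (if j = i then 1 else 0)"
  by (simp add: eps_def)

lemma eps_in_A: "i \<in> Ie \<Longrightarrow> eps i \<in> A"
  using \<pi>_ge[of i] by (auto simp: in_A_iff eps_apply)

lemma omult_eps_mon:
  assumes "i \<in> Ie" "u \<subseteq> Io"
  shows "mon (eps i, {}) \<odot> mon (0, u) = mon (eps i, u)"
proof -
  have "0 \<in> A" by (simp add: in_A_iff)
  then show ?thesis
    using assms eps_in_A by (simp add: omult_mon_eq binom_prod_def shuffle_sign_def inversions_def trunc_mon_def)
qed

lemma generators_subset_NN: "gensM p m n t \<union> gensN p m n t \<union> NNcomp p m n t 0 \<subseteq> (NN p m n t :: 'a witt set)"
proof -
  have mem: "D (mon (\<alpha>, u)) \<in> NN p m n t"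
    if "\<alpha> \<in> A" "u \<subseteq> Io" "even (card u)" "j \<in> Ie" "\<alpha> j \<noteq> \<pi> j" for \<alpha> u j
    unfolding NN_def using that
    by (intro witt.span_base CollectI exI[of _ \<alpha>] exI[of _ u]) (auto simp: BB0_iff)
  have other: "\<exists>j\<in>Ie. j \<noteq> i" for i
    using m_gt by (intro bexI[of _ "if i = 1 then 2 else 1"]) (auto simp: Y0_def)
  have "D (mon (\<lambda>j. q * eps i j, {})) \<in> NN p m n t" if i: "i \<in> Ie" "1 \<le> q" "q \<le> \<pi> i" for i q
  proof -
    obtain j where j: "j \<in> Ie" "j \<noteq> i" using other by blast
    have "(\<lambda>j. q * eps i j) \<in> A" using i by (auto simp: in_A_iff eps_apply)
    then show ?thesis
      using j \<pi>_ge[OF j(1)] by (intro mem[of _ _ j]) (auto simp: eps_apply)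
  qed
  then have M: "gensM p m n t \<subseteq> (NN p m n t :: 'a witt set)"
    unfolding gensM_def by blast
  have "D (mon (eps i, {}) \<odot> mon (0, u)) \<in> NN p m n t" if i: "i \<in> Ie" "u \<in> BBk m n 2" for i u
  proof -
    have u: "u \<subseteq> Io" "card u = 2" using i by (auto simp: BBk_def)
    then show ?thesis
      unfolding omult_eps_mon[OF i(1) u(1)] using i(1) eps_in_A[OF i(1)] \<pi>_ge[OF i(1)]
      by (intro mem[of _ _ i]) (simp_all add: eps_apply)
  qed
  then have N: "gensN p m n t \<subseteq> (NN p m n t :: 'a witt set)"
    unfolding gensN_def by blast
  show ?thesis using M N by (auto simp: NNcomp_def)
qed

section \<open>Brackets that are multiples of a single monomial\<close>

text \<open>
  Factor by factor, the binomial coefficient is \<open>1\<close>, or it is an entry of row \<open>p ^ t i - 1\<close> and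
  equals \<open>1\<close> or \<open>-1\<close>.
\<close>

lemma binom_prod_nonzero:
  assumes "\<And>i. i \<in> Ie \<Longrightarrow> \<alpha> i = 0 \<or> \<beta> i = 0 \<or> \<alpha> i + \<beta> i = \<pi> i"
  shows "binom_prod \<alpha> \<beta> \<noteq> 0"
proof -
  have "of_nat ((\<alpha> i + \<beta> i) choose \<alpha> i) \<noteq> (0 :: 'a)" if i: "i \<in> Ie" for i
  proof -
    consider "\<alpha> i = 0" | "\<beta> i = 0" | "\<alpha> i + \<beta> i = \<pi> i"
      using assms[OF i] by (elim disjE)
    then show ?thesis
    proof cases
      case 3
      then have "\<alpha> i < p ^ t i" using \<pi>_Suc[OF i] by linarith
      then show ?thesis
        unfolding 3 using of_nat_choose_prime_power_minus_one[OF prime_p char, of "\<alpha> i" "t i"]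
        by (simp add: \<pi>_eq i)
    qed auto
  qed
  then show ?thesis by (simp add: binom_prod_def)
qed

end

locale generating_subalgebra = hamiltonian_data p m n t scalars
  for p m n :: nat and t :: "nat \<Rightarrow> nat" and scalars :: "'a::field itself" +
  fixes L :: "'a witt set"
  assumes L: "lie_subalgebra p m n t L"
    and generators: "gensM p m n t \<union> gensN p m n t \<union> NNcomp p m n t 0 \<subseteq> L"
begin

definition inL :: "(nat \<Rightarrow> nat) \<Rightarrow> nat set \<Rightarrow> bool" where
  "inL \<alpha> u \<longleftrightarrow> \<alpha> \<in> A \<and> u \<subseteq> Io \<and> even (card u) \<and> D (mon (\<alpha>, u)) \<in> L"

lemma inLD: "inL \<alpha> u \<Longrightarrow> \<alpha> \<in> A" "inL \<alpha> u \<Longrightarrow> u \<subseteq> Io" "inL \<alpha> u \<Longrightarrow> even (card u)"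
  by (simp_all add: inL_def)

text \<open>
  Since \<open>L\<close> is a linear subspace, it suffices that one summand of the Poisson bracket is a nonzero
  multiple of a monomial and all others vanish.
\<close>

lemma inL_one_term:
  assumes a: "inL \<alpha> u" and b: "inL \<beta> v" and i: "i \<in> I"
    and zero: "\<And>k. k \<in> I \<Longrightarrow> k \<noteq> i \<Longrightarrow> \<partial> k (mon (\<alpha>, u)) \<odot> \<partial> (dual k) (mon (\<beta>, v)) = 0"
    and one: "\<partial> i (mon (\<alpha>, u)) \<odot> \<partial> (dual i) (mon (\<beta>, v)) = scaleO c (mon (\<gamma>, w))"
    and c: "c \<noteq> 0" and \<gamma>: "\<gamma> \<in> A" "w \<subseteq> Io" "even (card w)"
  shows "inL \<gamma> w"
proof -
  have "poisson (mon (\<alpha>, u)) (mon (\<beta>, v)) =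
      (\<Sum>k\<in>I. if k = i then scaleO (sg i * c) (mon (\<gamma>, w)) else 0)"
    unfolding poisson_def by (intro sum.cong refl) (auto simp: zero one)
  also have "\<dots> = scaleO (sg i * c) (mon (\<gamma>, w))"
    using i by (subst sum.delta) auto
  finally have P: "poisson (mon (\<alpha>, u)) (mon (\<beta>, v)) = scaleO (sg i * c) (mon (\<gamma>, w))" .
  have "has_parity 0 (mon (\<alpha>, u) :: 'a salg)" "has_parity 0 (mon (\<beta>, v) :: 'a salg)"
    using a b by (auto simp: inL_def Bas_eq intro!: has_parity_mon)
  then have "brk (D (mon (\<alpha>, u))) (D (mon (\<beta>, v))) = scaleW (sg i * c) (D (mon (\<gamma>, w)))"
    by (simp add: bracket_D P D_scale)
  moreover have "brk (D (mon (\<alpha>, u))) (D (mon (\<beta>, v))) \<in> L"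
    using L a b by (simp add: lie_subalgebra_def inL_def)
  ultimately have "scaleW (inverse (sg i * c)) (scaleW (sg i * c) (D (mon (\<gamma>, w)))) \<in> L"
    using L by (metis lie_subalgebra_def witt.subspace_scale)
  moreover have "inverse (sg i * c) * (sg i * c) = 1"
    using c by (intro left_inverse) simp
  ultimately have "D (mon (\<gamma>, w)) \<in> L"
    by (simp only: witt.scale_scale witt.scale_one)
  then show ?thesis
    using \<gamma> by (simp add: inL_def)
qed

text \<open>
  The bracket of $x^{(\varphi)}$ and $x^{(\alpha)}$ when only the index \<open>i\<close> contributes: at another
  index \<open>k\<close> one of the two derivatives is zero, or the product is cut off by truncation.
\<close>

lemma inL_shift:
  assumes a: "inL \<phi> {}" and b: "inL \<alpha> {}" and i: "i \<in> Ie" "0 < \<phi> i" "0 < \<alpha> (dual i)"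
    and binom_prod: "binom_prod (\<phi> - eps i) (\<alpha> - eps (dual i)) \<noteq> 0"
    and \<gamma>: "\<phi> - eps i + (\<alpha> - eps (dual i)) \<in> A"
    and other: "\<And>k. k \<in> Ie \<Longrightarrow> k \<noteq> i \<Longrightarrow>
      \<phi> k = 0 \<or> \<alpha> (dual k) = 0 \<or> \<phi> - eps k + (\<alpha> - eps (dual k)) \<notin> A"
  shows "inL (\<phi> - eps i + (\<alpha> - eps (dual i))) {}"
proof (rule inL_one_term[OF a b])
  show "i \<in> I" using i by (simp add: I_cases)
  note in_A = inLD(1)[OF a] inLD(1)[OF b]
  show "\<partial> i (mon (\<phi>, {})) \<odot> \<partial> (dual i) (mon (\<alpha>, {})) =
      scaleO (binom_prod (\<phi> - eps i) (\<alpha> - eps (dual i))) (mon (\<phi> - eps i + (\<alpha> - eps (dual i)), {}))"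
    using in_A i \<gamma> by (simp add: pd_mon_even dual_Ie omult_mon_eq A_minus_eps trunc_mon_def shuffle_sign_def inversions_def)
  fix k assume k: "k \<in> I" "k \<noteq> i"
  show "\<partial> k (mon (\<phi>, {})) \<odot> \<partial> (dual k) (mon (\<alpha>, {})) = 0"
  proof (cases "k \<in> Ie")
    case True
    then show ?thesis
      using in_A other[OF True k(2)] by (auto simp: pd_mon_even dual_Ie omult_mon_eq A_minus_eps trunc_mon_def)
  next
    case False
    then show ?thesis using k in_A by (simp add: I_cases pd_mon_odd)
  qed
qed (use binom_prod \<gamma> in auto)

text \<open>
  Bracketing with $x_i x^v$, where \<open>v\<close> is disjoint from \<open>u\<close>: only $\partial_i$ can act on $x_i x^v$
  without meeting a zero derivative, so the odd variables of \<open>v\<close> are adjoined and the exponent at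
  \<open>dual i\<close> drops by one.  For \<open>v = {}\<close> this is plain lowering.
\<close>

lemma inL_union:
  assumes a: "inL (eps i) v" and b: "inL \<alpha> u" and i: "i \<in> Ie" "0 < \<alpha> (dual i)" and uv: "u \<inter> v = {}"
  shows "inL (\<alpha> - eps (dual i)) (u \<union> v)"
proof (rule inL_one_term[OF a b])
  show "i \<in> I" using i by (simp add: I_cases)
  note in_A = inLD(1,2)[OF a] inLD(1,2)[OF b]
  have fin: "finite u" "finite v" using in_A finite_subset[OF _ finite_Io] by auto
  have eq: "0 + (\<alpha> - eps (dual i)) = \<alpha> - eps (dual i)" "eps i - eps i = 0"
    by (auto simp: fun_eq_iff)
  have "0 \<in> A" by (simp add: in_A_iff)
  then show "\<partial> i (mon (eps i, v)) \<odot> \<partial> (dual i) (mon (\<alpha>, u)) =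
      scaleO (binom_prod 0 (\<alpha> - eps (dual i)) * shuffle_sign v u) (mon (\<alpha> - eps (dual i), u \<union> v))"
    using in_A i by (simp add: pd_mon_even dual_Ie omult_mon_eq A_minus_eps trunc_mon_def eq eps_apply Un_commute)
  show "binom_prod 0 (\<alpha> - eps (dual i)) * shuffle_sign v u \<noteq> 0"
    using uv binom_prod_nonzero[of 0] by (simp add: shuffle_sign_def Int_commute)
  show "even (card (u \<union> v))"
    using inLD(3)[OF a] inLD(3)[OF b] fin uv by (simp add: card_Un_disjoint)
  show "\<alpha> - eps (dual i) \<in> A" "u \<union> v \<subseteq> Io"
    using in_A by (auto intro: A_minus_eps)
  fix k assume k: "k \<in> I" "k \<noteq> i"
  show "\<partial> k (mon (eps i, v)) \<odot> \<partial> (dual k) (mon (\<alpha>, u)) = 0"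
  proof (cases "k \<in> Ie")
    case True
    then show ?thesis
      using in_A k by (simp add: pd_mon_even eps_apply)
  next
    case False
    then have "k \<in> Io" using k by (simp add: I_cases)
    then show ?thesis using in_A uv by (auto simp: pd_mon_odd dual_Io)
  qed
qed

text \<open>
  If the odd parts share exactly \<open>k\<close>, the even derivatives give nothing because $x^u x^v = 0$, and
  $\partial_k$ removes the common variable from both factors while the even parts are multiplied.
\<close>

lemma inL_contract:
  assumes a: "inL \<alpha> u" and b: "inL \<beta> v" and uv: "u \<inter> v = {k}"
    and \<gamma>: "\<alpha> + \<beta> \<in> A" and binom_prod: "binom_prod \<alpha> \<beta> \<noteq> 0"
  shows "inL (\<alpha> + \<beta>) (u \<union> v - {k})"
proof -
  note in_A = inLD(1,2)[OF a] inLD(1,2)[OF b]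
  have fin: "finite u" "finite v" using in_A finite_subset[OF _ finite_Io] by auto
  have k: "k \<in> u" "k \<in> v" using uv by auto
  then have kIo: "k \<in> Io" using in_A by auto
  have sub: "u - {k} \<subseteq> Io" "v - {k} \<subseteq> Io" using in_A by auto
  have un: "(u - {k}) \<union> (v - {k}) = u \<union> v - {k}" by auto
  have disj: "(u - {k}) \<inter> (v - {k}) = {}" using uv by auto
  define c :: 'a where "c = (-1) ^ card {j \<in> u. j < k} * ((-1) ^ card {j \<in> v. j < k} *
      (binom_prod \<alpha> \<beta> * shuffle_sign (u - {k}) (v - {k})))"
  show ?thesis
  proof (rule inL_one_term[OF a b])
    show "k \<in> I" using kIo by (simp add: I_cases)
    show "\<partial> k (mon (\<alpha>, u)) \<odot> \<partial> (dual k) (mon (\<beta>, v)) = scaleO c (mon (\<alpha> + \<beta>, u \<union> v - {k}))"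
      using in_A sub k kIo \<gamma> by (simp add: dual_Io pd_mon_odd omult_scale_left omult_scale_right
          omult_mon_eq un trunc_mon_def c_def)
    show "c \<noteq> 0" using binom_prod disj by (simp add: c_def shuffle_sign_def)
    have "card (u - {k}) = card u - 1" "card (v - {k}) = card v - 1" "card u > 0" "card v > 0"
      using k fin card_gt_0_iff by (auto simp: card_Diff_singleton)
    then show "even (card (u \<union> v - {k}))"
      unfolding un[symmetric] using inLD(3)[OF a] inLD(3)[OF b] fin disj
      by (subst card_Un_disjoint) auto
    show "\<alpha> + \<beta> \<in> A" "u \<union> v - {k} \<subseteq> Io" using \<gamma> in_A by auto
    fix j assume j: "j \<in> I" "j \<noteq> k"
    show "\<partial> j (mon (\<alpha>, u)) \<odot> \<partial> (dual j) (mon (\<beta>, v)) = 0"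
    proof (cases "j \<in> Ie")
      case True
      have "shuffle_sign u v = 0" using k by (auto simp: shuffle_sign_def)
      then show ?thesis
        using True in_A by (simp add: pd_mon_even dual_Ie omult_mon_eq A_minus_eps)
    next
      case False
      then have jIo: "j \<in> Io" using j by (simp add: I_cases)
      then have "j \<notin> u \<or> j \<notin> v" using uv j by auto
      then show ?thesis using in_A jIo by (auto simp: pd_mon_odd dual_Io)
    qed
  qed
qed

section \<open>The generators as monomials\<close>

lemma inL_power:
  assumes "i \<in> Ie" "1 \<le> q" "q \<le> \<pi> i"
  shows "inL (\<lambda>j. q * eps i j) {}"
proof -
  have "D (mon (\<lambda>j. q * eps i j, {})) \<in> gensM p m n t"
    unfolding gensM_def using assms by blast
  moreover have "(\<lambda>j. q * eps i j) \<in> A"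
    using assms by (auto simp: in_A_iff eps_apply)
  ultimately show ?thesis
    using generators by (auto simp: inL_def)
qed

lemma inL_eps: "i \<in> Ie \<Longrightarrow> inL (eps i) {}"
  using inL_power[of i 1] \<pi>_ge[of i] by simp

lemma inL_eps_pair:
  assumes "i \<in> Ie" "u \<subseteq> Io" "card u = 2"
  shows "inL (eps i) u"
proof -
  have "D (mon (eps i, {}) \<odot> mon (0, u)) \<in> gensN p m n t"
    unfolding gensN_def BBk_def using assms by blast
  then show ?thesis
    using generators assms eps_in_A by (auto simp: inL_def omult_eps_mon)
qed

text \<open>
  These monomials come from the generators of degree zero: both derivatives are linear, so the field
  lies in the component of degree zero.
\<close>

lemma inL_quadratic:
  assumes i: "i \<in> Ie" and j: "j \<in> Ie" and ij: "i \<noteq> j"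
  shows "inL (eps i + eps j) {}"
proof -
  let ?\<alpha> = "eps i + eps j"
  have A: "?\<alpha> \<in> A"
    using \<pi>_ge[OF i] \<pi>_ge[OF j] ij by (auto simp: in_A_iff eps_apply)
  have "?\<alpha> \<noteq> \<pi>"
    using \<pi>_ge[OF i] ij by (auto simp: fun_eq_iff eps_apply intro!: exI[of _ i])
  then have "D (mon (?\<alpha>, {})) \<in> NN p m n t"
    unfolding NN_def using A
    by (intro witt.span_base CollectI exI[of _ ?\<alpha>] exI[of _ "{}"]) (auto simp: BB0_iff)
  moreover have "D (mon (?\<alpha>, {})) \<in> Wcomp p m n t 0"
  proof -
    have "ohomogeneous p m n t (0 + 1) (\<partial> k (mon (?\<alpha>, {})))" if k: "k \<in> I" for k
    proof -
      have hom: "ohomogeneous p m n t (0 + 1) (mon (eps l, {}) :: 'a salg)" if l: "l \<in> Ie" for l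
      proof -
        have "(\<Sum>x\<in>Ie. eps l x) = 1" using l by (simp add: eps_apply)
        then have "(\<Sum>x\<in>Ie. int (eps l x)) = 1" by (simp only: of_nat_sum[symmetric] of_nat_1)
        then show ?thesis
          using l eps_in_A[OF l]
          by (auto simp: ohomogeneous_def Oalg_def mon_def Bas_eq)
      qed
      have hom0: "ohomogeneous p m n t (0 + 1) (0 :: 'a salg)"
        by (simp add: ohomogeneous_def Oalg_def)
      have eqs: "?\<alpha> - eps i = eps j" "?\<alpha> - eps j = eps i"
        by (auto simp: fun_eq_iff)
      show ?thesis
      proof (cases "k \<in> Ie")
        case True
        have "k = i \<or> k = j \<or> ?\<alpha> k = 0" by (simp add: eps_apply)
        then consider "k = i" | "k = j" | "?\<alpha> k = 0" by (elim disjE)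
        then show ?thesis
          using True A i j ij hom hom0 by cases (simp_all add: pd_mon_even eqs eps_apply)
      next
        case False
        then show ?thesis using k A hom0 by (simp add: I_cases pd_mon_odd)
      qed
    qed
    then have "dterm (\<partial> k (mon (?\<alpha>, {}))) (dual k) \<in> Wcomp p m n t 0" if "k \<in> I" for k
      unfolding Wcomp_def using that dual_I by (intro witt.span_base) blast
    then have "mono_DH p m n t (?\<alpha>, {}) \<in> (Wcomp p m n t 0 :: 'a witt set)"
      unfolding mono_DH_def Wcomp_def by (intro witt.span_sum witt.span_scale) simp_all
    moreover have "D (mon (?\<alpha>, {})) = mono_DH p m n t (?\<alpha>, {})"
      using A by (intro D_mon) (simp add: Bas_eq)
    ultimately show ?thesis by (simp only:)
  qed
  ultimately show ?thesis
    using generators A by (auto simp: NNcomp_def inL_def)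
qed

section \<open>Purely even monomials\<close>

lemma inL_lower:
  assumes "inL \<alpha> u" "j \<in> Ie" "0 < \<alpha> j"
  shows "inL (\<alpha> - eps j) u"
proof -
  have "dual (dual j) = j" using assms by (simp add: dual_dual I_cases)
  then show ?thesis
    using inL_union[OF inL_eps[OF dual_Ie[OF assms(2)]] assms(1) dual_Ie[OF assms(2)]] assms by simp
qed

lemma inL_le:
  assumes "inL \<beta> u" "\<And>i. \<alpha> i \<le> \<beta> i"
  shows "inL \<alpha> u"
  using assms
proof (induction "\<Sum>i\<in>Ie. \<beta> i - \<alpha> i" arbitrary: \<beta> rule: less_induct)
  case less
  show ?case
  proof (cases "\<alpha> = \<beta>")
    case True
    then show ?thesis using less.prems by simp
  next
    case False
    then obtain j where j: "\<alpha> j < \<beta> j" using less.prems(2) by (metis ext le_neq_implies_less)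
    then have jIe: "j \<in> Ie" using A_outside[OF inLD(1)[OF less.prems(1)]] by (metis not_less_zero)
    have "inL (\<beta> - eps j) u" using inL_lower[OF less.prems(1) jIe] j by simp
    moreover have "(\<Sum>i\<in>Ie. (\<beta> - eps j) i - \<alpha> i) < (\<Sum>i\<in>Ie. \<beta> i - \<alpha> i)"
      by (rule sum_strict_mono_ex1) (use j jIe in \<open>auto simp: eps_apply intro!: bexI[of _ j]\<close>)
    moreover have "\<alpha> i \<le> (\<beta> - eps j) i" for i
      using less.prems(2)[of i] j by (auto simp: eps_apply)
    ultimately show ?thesis using less.hyps by blast
  qed
qed

text \<open>
  Bracketing with $x^{((q+1)\varepsilon_i)}$ differentiates at \<open>dual i\<close> and multiplies by
  $x^{(q\varepsilon_i)}$; the coefficient $\binom{\alpha_i + q}{q}$ is nonzero by the hypothesis \<open>top\<close>.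
\<close>

lemma inL_raise:
  assumes a: "inL \<alpha> {}" and i: "i \<in> Ie" "0 < \<alpha> (dual i)" and q: "1 \<le> q" "q < \<pi> i" "\<alpha> i + q \<le> \<pi> i"
    and top: "\<alpha> i = 0 \<or> \<alpha> i + q = \<pi> i"
  shows "inL (\<alpha>(i := \<alpha> i + q, dual i := \<alpha> (dual i) - 1)) {}"
proof -
  let ?\<phi> = "\<lambda>j. Suc q * eps i j"
  let ?\<gamma> = "\<alpha>(i := \<alpha> i + q, dual i := \<alpha> (dual i) - 1)"
  have \<gamma>: "?\<phi> - eps i + (\<alpha> - eps (dual i)) = ?\<gamma>"
    using dual_neq[OF i(1)] by (auto simp: fun_eq_iff eps_apply)
  have "?\<phi> - eps i + (\<alpha> - eps (dual i)) \<in> A"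
    unfolding \<gamma> using inLD(1)[OF a] q dual_neq[OF i(1)] by (auto simp: in_A_iff intro: le_trans[OF diff_le_self])
  moreover have "binom_prod (?\<phi> - eps i) (\<alpha> - eps (dual i)) \<noteq> 0"
    using top dual_neq[OF i(1)] by (intro binom_prod_nonzero) (auto simp: eps_apply)
  ultimately have "inL (?\<phi> - eps i + (\<alpha> - eps (dual i))) {}"
    using i q by (intro inL_shift inL_power a) (auto simp: eps_apply)
  then show ?thesis unfolding \<gamma> .
qed

text \<open>
  Bracketing with $x_i x^{(d\varepsilon_j)}$ moves weight from \<open>dual i\<close> to \<open>j\<close>.  The unwanted second
  term, which differentiates at \<open>dual j\<close> and multiplies by $x_i$, vanishes by the hypothesis \<open>kill\<close>:
  either the derivative is zero, or the exponent at \<open>i\<close> is already maximal.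
\<close>

lemma inL_transfer:
  assumes f: "inL (\<lambda>k. eps i k + d * eps j k) {}" and a: "inL \<alpha> {}"
    and ij: "i \<in> Ie" "j \<in> Ie" "j \<noteq> i" "j \<noteq> dual i" and pos: "0 < \<alpha> (dual i)" and d: "\<alpha> j + d \<le> \<pi> j"
    and top: "\<alpha> j = 0 \<or> \<alpha> j + d = \<pi> j" and kill: "\<alpha> (dual j) = 0 \<or> \<alpha> i = \<pi> i"
  shows "inL (\<alpha>(dual i := \<alpha> (dual i) - 1, j := \<alpha> j + d)) {}"
proof -
  let ?\<phi> = "\<lambda>k. eps i k + d * eps j k"
  let ?\<gamma> = "\<alpha>(dual i := \<alpha> (dual i) - 1, j := \<alpha> j + d)"
  have dj: "dual j \<noteq> i" using ij by (metis I_cases dual_dual)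
  have \<gamma>: "?\<phi> - eps i + (\<alpha> - eps (dual i)) = ?\<gamma>"
    using ij by (auto simp: fun_eq_iff eps_apply)
  have "?\<phi> - eps i + (\<alpha> - eps (dual i)) \<in> A"
    unfolding \<gamma> using inLD(1)[OF a] d by (auto simp: in_A_iff intro: le_trans[OF diff_le_self])
  moreover have "binom_prod (?\<phi> - eps i) (\<alpha> - eps (dual i)) \<noteq> 0"
    using top ij by (intro binom_prod_nonzero) (auto simp: eps_apply)
  moreover have "?\<phi> k = 0 \<or> \<alpha> (dual k) = 0 \<or> ?\<phi> - eps k + (\<alpha> - eps (dual k)) \<notin> A"
    if "k \<in> Ie" "k \<noteq> i" for k
  proof (cases "k = j")
    case True
    have "?\<phi> - eps j + (\<alpha> - eps (dual j)) \<notin> A" if "\<alpha> i = \<pi> i"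
      using that ij dj by (auto simp: in_A_iff eps_apply not_le intro!: exI[of _ i])
    then show ?thesis using kill True by blast
  next
    case False
    then show ?thesis using that by (simp add: eps_apply)
  qed
  ultimately have "inL (?\<phi> - eps i + (\<alpha> - eps (dual i))) {}"
    using ij pos by (intro inL_shift[OF f a]) (auto simp: eps_apply)
  then show ?thesis unfolding \<gamma> .
qed

text \<open>
  The multiplier for \<open>inL_transfer\<close> with \<open>d = 2\<close> arises from $x_{j'} x_i$ by bracketing with
  $x^{(3\varepsilon_j)}$.
\<close>

lemma inL_cubic:
  assumes ij: "i \<in> Ie" "j \<in> Ie" "j \<noteq> i" "j \<noteq> dual i"
  shows "inL (\<lambda>k. eps i k + 2 * eps j k) {}"
proof -
  have dj: "dual j \<in> Ie" "dual j \<noteq> i" "dual j \<noteq> j"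
    using ij by (metis dual_Ie, metis I_cases dual_dual, metis dual_neq)
  let ?\<alpha> = "eps (dual j) + eps i"
  have "inL (?\<alpha>(j := ?\<alpha> j + 2, dual j := ?\<alpha> (dual j) - 1)) {}"
    using ij dj \<pi>_ge[OF ij(2)] inL_quadratic[OF dj(1) ij(1) dj(2)]
    by (intro inL_raise) (auto simp: eps_apply)
  moreover have "?\<alpha>(j := ?\<alpha> j + 2, dual j := ?\<alpha> (dual j) - 1) = (\<lambda>k. eps i k + 2 * eps j k)"
    using ij dj by (auto simp: fun_eq_iff eps_apply)
  ultimately show ?thesis by simp
qed

text \<open>
  Two deficits of one, at \<open>a\<close> and \<open>b\<close>, are merged into a single one at \<open>dual a\<close>, so that the degree
  grows by one.  If \<open>b = dual a\<close>, one works inside the pair, where the deficits change as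
  $(1,1) \to (0,2) \to (1,0) \to (0,1)$.  Otherwise the quadratic $x_{a'} x_b$ moves the deficit from
  \<open>b\<close> to \<open>a\<close>, and the resulting deficit of two at \<open>a\<close> is filled by a cubic at the cost of one
  at \<open>dual a\<close>.
\<close>

lemma inL_fuse:
  assumes a: "inL \<alpha> {}" and ab: "a \<in> Ie" "b \<in> Ie" "a \<noteq> b"
    and def: "\<alpha> a = \<pi> a - 1" "\<alpha> b = \<pi> b - 1" and full: "b = dual a \<or> \<alpha> (dual a) = \<pi> (dual a)"
  shows "inL (\<alpha>(a := \<pi> a, b := \<pi> b, dual a := \<pi> (dual a) - 1)) {}"
proof (cases "b = dual a")
  case True
  have da: "dual a \<in> Ie" "dual a \<noteq> a" "dual (dual a) = a"
    using ab dual_Ie dual_neq dual_dual I_cases by auto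
  have ge: "3 \<le> \<pi> a" "3 \<le> \<pi> (dual a)" using \<pi>_ge ab da by auto
  define \<beta> where "\<beta> = \<alpha>(a := \<pi> a, dual a := \<pi> (dual a) - 2)"
  have "inL (\<alpha>(a := \<alpha> a + 1, dual a := \<alpha> (dual a) - 1)) {}"
    using ab da ge def True by (intro inL_raise a) auto
  moreover have "\<alpha>(a := \<alpha> a + 1, dual a := \<alpha> (dual a) - 1) = \<beta>"
    using def True ge by (auto simp: \<beta>_def fun_eq_iff)
  ultimately have \<beta>: "inL \<beta> {}" by simp
  define \<gamma> where "\<gamma> = \<alpha>(a := \<pi> a - 1, dual a := \<pi> (dual a))"
  have "inL (\<beta>(dual a := \<beta> (dual a) + 2, dual (dual a) := \<beta> (dual (dual a)) - 1)) {}"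
    using ab da ge by (intro inL_raise \<beta>) (auto simp: \<beta>_def)
  moreover have "\<beta>(dual a := \<beta> (dual a) + 2, dual (dual a) := \<beta> (dual (dual a)) - 1) = \<gamma>"
    using da ge by (auto simp: \<beta>_def \<gamma>_def fun_eq_iff)
  ultimately have \<gamma>: "inL \<gamma> {}" by simp
  have "inL (\<gamma>(a := \<gamma> a + 1, dual a := \<gamma> (dual a) - 1)) {}"
    using ab da ge by (intro inL_raise \<gamma>) (auto simp: \<gamma>_def)
  moreover have "\<gamma>(a := \<gamma> a + 1, dual a := \<gamma> (dual a) - 1) =
      \<alpha>(a := \<pi> a, b := \<pi> b, dual a := \<pi> (dual a) - 1)"
    using da ge True by (auto simp: \<gamma>_def fun_eq_iff)
  ultimately show ?thesis by simp
next
  case False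
  have da: "dual a \<in> Ie" "dual a \<noteq> a" "dual (dual a) = a"
    using ab dual_Ie dual_neq dual_dual I_cases by auto
  have ge: "3 \<le> \<pi> a" "3 \<le> \<pi> b" "3 \<le> \<pi> (dual a)" using \<pi>_ge ab da by auto
  have quad: "inL (\<lambda>k. eps (dual a) k + 1 * eps b k) {}"
    using inL_quadratic[OF da(1) ab(2)] False by (simp add: plus_fun_def)
  define \<beta> where "\<beta> = \<alpha>(a := \<pi> a - 2, b := \<pi> b)"
  have "inL (\<alpha>(dual (dual a) := \<alpha> (dual (dual a)) - 1, b := \<alpha> b + 1)) {}"
    by (rule inL_transfer[OF quad a]) (use ab da ge def full False in auto)
  moreover have "\<alpha>(dual (dual a) := \<alpha> (dual (dual a)) - 1, b := \<alpha> b + 1) = \<beta>"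
    using def da ge by (auto simp: \<beta>_def fun_eq_iff)
  ultimately have \<beta>: "inL \<beta> {}" by simp
  have "inL (\<beta>(a := \<beta> a + 2, dual a := \<beta> (dual a) - 1)) {}"
    using ab da ge full False by (intro inL_raise \<beta>) (auto simp: \<beta>_def)
  moreover have "\<beta>(a := \<beta> a + 2, dual a := \<beta> (dual a) - 1) =
      \<alpha>(a := \<pi> a, b := \<pi> b, dual a := \<pi> (dual a) - 1)"
    using da ge ab full False by (auto simp: \<beta>_def fun_eq_iff)
  ultimately show ?thesis by simp
qed

lemma sum_fun_upd:
  assumes "i \<in> Ie"
  shows "(\<Sum>k\<in>Ie. (\<alpha>(i := x)) k) + \<alpha> i = (\<Sum>k\<in>Ie. \<alpha> k) + (x :: nat)"
  using assms by (simp add: sum.remove[of Ie i])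

text \<open>
  Take $x^{(\alpha)}$ in \<open>L\<close> of maximal degree.  No raising move applies, so every pair of dual
  exponents is either zero or nearly maximal in both entries (\<open>large\<close>); a zero pair could be fed from
  a full one by a transfer (\<open>pos\<close>), and two deficits could be fused (\<open>unique\<close>).
\<close>

lemma exists_submaximal: "\<exists>i\<in>Ie. inL (\<pi>(i := \<pi> i - 1)) {}"
proof -
  define deg where "deg \<alpha> = (\<Sum>k\<in>Ie. \<alpha> k)" for \<alpha> :: "nat \<Rightarrow> nat"
  have deg_upd: "deg (\<alpha>(i := x)) + \<alpha> i = deg \<alpha> + x" if "i \<in> Ie" for \<alpha> i x
    unfolding deg_def by (rule sum_fun_upd[OF that])
  have one: "1 \<in> Ie" using m_gt by (simp add: Y0_def)
  define S where "S = {\<alpha>. inL \<alpha> {}}"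
  have "S \<subseteq> A" by (auto simp: S_def inL_def)
  then have fin: "finite (deg ` S)" using finite_subset[OF _ finite_A] by blast
  have "deg ` S \<noteq> {}" using inL_eps[OF one] by (auto simp: S_def)
  with fin have "Max (deg ` S) \<in> deg ` S" by (rule Max_in)
  then obtain \<alpha> where \<alpha>: "\<alpha> \<in> S" "Max (deg ` S) = deg \<alpha>" by blast
  have \<alpha>_max: "deg \<beta> \<le> deg \<alpha>" if "\<beta> \<in> S" for \<beta>
    using Max_ge[OF fin imageI[OF that]] \<alpha>(2) by simp
  have L\<alpha>: "inL \<alpha> {}" using \<alpha> by (simp add: S_def)
  have max: "deg \<beta> \<le> deg \<alpha>" if "inL \<beta> {}" for \<beta> using \<alpha>_max that by (simp add: S_def)
  have le: "\<alpha> k \<le> \<pi> k" for k using inLD(1)[OF L\<alpha>] by (simp add: in_A_iff)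
  have dual: "dual i \<in> Ie" "dual i \<noteq> i" "dual (dual i) = i" if "i \<in> Ie" for i
    using that dual_Ie dual_neq dual_dual I_cases by auto
  have large: "\<pi> i - 1 \<le> \<alpha> i" if i: "i \<in> Ie" and pos: "0 < \<alpha> (dual i)" for i
  proof (rule ccontr)
    assume small: "\<not> \<pi> i - 1 \<le> \<alpha> i"
    \<comment> \<open>From exponent zero, a step of two has coefficient one and stays within the range; otherwise
      the exponent is raised to its maximum.  Either way the degree grows by at least one.\<close>
    define q where "q = (if \<alpha> i = 0 then 2 else \<pi> i - \<alpha> i)"
    have q: "2 \<le> q" using small by (auto simp: q_def)
    have "inL (\<alpha>(i := \<alpha> i + q, dual i := \<alpha> (dual i) - 1)) {}"
      using small \<pi>_ge[OF i] i pos by (intro inL_raise L\<alpha>) (auto simp: q_def)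
    from max[OF this] show False
      using deg_upd[OF i, of \<alpha> "\<alpha> i + q"] deg_upd[OF dual(1)[OF i], of "\<alpha>(i := \<alpha> i + q)" "\<alpha> (dual i) - 1"]
        dual(2)[OF i] pos q by simp
  qed
  obtain i where i: "i \<in> Ie" "0 < \<alpha> i"
  proof -
    have "deg (eps 1) = 1" using one by (simp add: deg_def eps_apply)
    then have "deg \<alpha> \<noteq> 0" using max[OF inL_eps[OF one]] by simp
    then show ?thesis using that by (auto simp: deg_def)
  qed
  have "0 < \<alpha> (dual i)"
    using large[OF dual(1)[OF i(1)]] \<pi>_ge[OF dual(1)[OF i(1)]] dual(3)[OF i(1)] i by simp
  have pos: "0 < \<alpha> j" if j: "j \<in> Ie" for j
  proof (rule ccontr)
    assume "\<not> 0 < \<alpha> j"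
    then have zero: "\<alpha> j = 0" "\<alpha> (dual j) = 0" using large[OF j] \<pi>_ge[OF j] by auto
    have ij: "j \<noteq> i" "j \<noteq> dual i" "dual j \<noteq> i"
      using zero i \<open>0 < \<alpha> (dual i)\<close> by auto
    have "inL (\<alpha>(dual (dual i) := \<alpha> (dual (dual i)) - 1, j := \<alpha> j + 2)) {}"
      by (rule inL_transfer[OF inL_cubic L\<alpha>])
        (use i j ij zero dual[OF i(1)] \<pi>_ge[OF j] in auto)
    from max[OF this] show False
      using deg_upd[OF i(1), of \<alpha> "\<alpha> i - 1"] deg_upd[OF j, of "\<alpha>(i := \<alpha> i - 1)" 2]
        dual(3)[OF i(1)] ij zero i by (simp add: numeral_2_eq_2)
  qed
  have ge: "\<pi> j - 1 \<le> \<alpha> j" if "j \<in> Ie" for j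
    by (rule large[OF that pos[OF dual(1)[OF that]]])
  \<comment> \<open>The merge partner of \<open>a\<close> is \<open>dual a\<close> if that entry is deficient, since fusing with any other
    entry requires the exponent at \<open>dual a\<close> to be maximal.\<close>
  have unique: "a = b" if ab: "a \<in> Ie" "b \<in> Ie" "\<alpha> a \<noteq> \<pi> a" "\<alpha> b \<noteq> \<pi> b" for a b
  proof (rule ccontr)
    assume "a \<noteq> b"
    define c where "c = (if \<alpha> (dual a) = \<pi> (dual a) then b else dual a)"
    have c: "c \<in> Ie" "a \<noteq> c" "\<alpha> c \<noteq> \<pi> c" "c = dual a \<or> \<alpha> (dual a) = \<pi> (dual a)"
      using ab \<open>a \<noteq> b\<close> dual(1,2)[OF ab(1)] by (auto simp: c_def)
    have val: "\<alpha> a = \<pi> a - 1" "\<alpha> c = \<pi> c - 1" "\<pi> a \<ge> 3" "\<pi> c \<ge> 3"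
      using ge[OF ab(1)] ge[OF c(1)] le[of a] le[of c] ab(3) c(3) \<pi>_ge ab(1) c(1) by auto
    have "inL (\<alpha>(a := \<pi> a, c := \<pi> c, dual a := \<pi> (dual a) - 1)) {}"
      by (rule inL_fuse[OF L\<alpha> ab(1) c(1,2) val(1,2) c(4)])
    from max[OF this] show False
      using deg_upd[OF ab(1), of \<alpha> "\<pi> a"] deg_upd[OF c(1), of "\<alpha>(a := \<pi> a)" "\<pi> c"]
        deg_upd[OF dual(1)[OF ab(1)], of "\<alpha>(a := \<pi> a, c := \<pi> c)" "\<pi> (dual a) - 1"]
        dual(2)[OF ab(1)] c val by (cases "c = dual a") auto
  qed
  show ?thesis
  proof (cases "\<exists>a\<in>Ie. \<alpha> a \<noteq> \<pi> a")
    case True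
    then obtain a where a: "a \<in> Ie" "\<alpha> a \<noteq> \<pi> a" by blast
    have "\<alpha> k = (\<pi>(a := \<pi> a - 1)) k" for k
    proof (cases "k = a")
      case True
      then show ?thesis using ge[OF a(1)] le[of a] a by simp
    next
      case False
      then show ?thesis
        using unique[OF a(1) _ a(2), of k] A_outside[OF inLD(1)[OF L\<alpha>], of k]
        by (cases "k \<in> Ie") (auto simp: pimax_def)
    qed
    then have "\<alpha> = \<pi>(a := \<pi> a - 1)" by blast
    then show ?thesis using L\<alpha> a by metis
  next
    case False
    have "inL (\<pi>(1 := \<pi> 1 - 1)) {}"
    proof (rule inL_le[OF L\<alpha>])
      fix k
      show "(\<pi>(1 := \<pi> 1 - 1)) k \<le> \<alpha> k"
        using False one by (cases "k \<in> Ie") (auto simp: pimax_def)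
    qed
    then show ?thesis using one by blast
  qed
qed

text \<open>
  Lowering the known monomial at one more position creates two deficits, which are fused so that the
  remaining one lies at \<open>j\<close>.
\<close>

lemma inL_submaximal:
  assumes j: "j \<in> Ie"
  shows "inL (\<pi>(j := \<pi> j - 1)) {}"
proof -
  obtain i where i: "i \<in> Ie" "inL (\<pi>(i := \<pi> i - 1)) {}" using exists_submaximal by blast
  have dj: "dual j \<in> Ie" "dual j \<noteq> j" "dual (dual j) = j"
    using j dual_Ie dual_neq dual_dual I_cases by auto
  define a where "a = dual j"
  define b where "b = (if i = dual j then j else i)"
  show ?thesis
  proof (cases "i = j")
    case False
    have ab: "a \<in> Ie" "b \<in> Ie" "a \<noteq> b" "b = dual a \<or> b \<noteq> j"
      using i j dj False by (auto simp: a_def b_def)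
    have "inL (\<pi>(a := \<pi> a - 1, b := \<pi> b - 1)) {}"
    proof (cases "i = dual j")
      case True
      have "\<pi>(a := \<pi> a - 1, b := \<pi> b - 1) = \<pi>(i := \<pi> i - 1) - eps j"
        using True dj by (auto simp: a_def b_def fun_eq_iff eps_apply)
      then show ?thesis
        using inL_lower[OF i(2) j] True dj \<pi>_ge[OF j] by simp
    next
      case neq: False
      have "\<pi>(a := \<pi> a - 1, b := \<pi> b - 1) = \<pi>(i := \<pi> i - 1) - eps (dual j)"
        using neq by (auto simp: a_def b_def fun_eq_iff eps_apply)
      then show ?thesis
        using inL_lower[OF i(2) dj(1)] neq \<pi>_ge[OF dj(1)] by simp
    qed
    from inL_fuse[OF this ab(1,2,3)] have
      "inL (\<pi>(a := \<pi> a - 1, b := \<pi> b - 1, a := \<pi> a, b := \<pi> b, dual a := \<pi> (dual a) - 1)) {}"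
      using ab dj by (auto simp: a_def)
    moreover have "\<pi>(a := \<pi> a - 1, b := \<pi> b - 1, a := \<pi> a, b := \<pi> b, dual a := \<pi> (dual a) - 1) =
        \<pi>(j := \<pi> j - 1)"
      using dj by (auto simp: a_def fun_eq_iff)
    ultimately show ?thesis by simp
  qed (use i in simp)
qed

lemma A_below_submaximal:
  assumes "\<alpha> \<in> A" "\<alpha> \<noteq> \<pi>"
  obtains j where "j \<in> Ie" "\<And>k. \<alpha> k \<le> (\<pi>(j := \<pi> j - 1)) k"
proof -
  obtain j where j: "\<alpha> j < \<pi> j"
    using assms unfolding in_A_iff by (metis ext le_neq_implies_less)
  then have "j \<in> Ie" by (auto simp: pimax_def split: if_splits)
  moreover have "\<alpha> k \<le> (\<pi>(j := \<pi> j - 1)) k" for k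
    using j assms(1) by (auto simp: in_A_iff)
  ultimately show ?thesis using that by blast
qed

lemma inL_even:
  assumes "\<alpha> \<in> A" "\<alpha> \<noteq> \<pi>"
  shows "inL \<alpha> {}"
  using A_below_submaximal[OF assms] inL_submaximal inL_le by metis

section \<open>Monomials with odd variables\<close>

lemma \<pi>_in_A: "\<pi> \<in> A"
  by (simp add: in_A_iff)

text \<open>
  Exponents that add up to \<open>\<pi>\<close> give binomial coefficients from the rows \<open>p ^ t i - 1\<close>, so
  contraction always reaches the full exponent.
\<close>

lemma inL_contract_top:
  assumes "inL \<alpha> u" "inL \<beta> v" "u \<inter> v = {k}" "\<alpha> + \<beta> = \<pi>"
  shows "inL \<pi> (u \<union> v - {k})"
proof -
  have "binom_prod \<alpha> \<beta> \<noteq> 0"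
    using assms(4) by (intro binom_prod_nonzero) (metis plus_fun_apply)
  then show ?thesis
    using inL_contract[OF assms(1-3)] assms(4) \<pi>_in_A by simp
qed

text \<open>
  By adjunction of two odd variables to $x^{(\alpha + \varepsilon_1)}$ one gets $x^{(\alpha)} x_k x_l$
  whenever $\alpha + \varepsilon_1 \ne \pi$.  The full exponent is then reached by contracting
  $x^{(\pi - 2\varepsilon_1)} x_k x_l$ with $x^{(2\varepsilon_1)} x_l x_s$ for an odd index \<open>l\<close> outside
  \<open>u\<close>.  The splitting uses $2\varepsilon_1$ because $x^{(\pi - \varepsilon_1)} x_k x_l$ would have to
  come from the excluded $x^{(\pi)}$.
\<close>

lemma inL_two:
  assumes u: "u \<subseteq> Io" "card u = 2"
  shows "inL \<pi> u"
proof -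
  have one: "1 \<in> Ie" and two: "2 \<in> Ie" using m_gt by (auto simp: Y0_def)
  have eps: "inL \<alpha> v" if v: "v \<subseteq> Io" "card v = 2" and "\<alpha> 1 + 1 \<le> \<pi> 1" "\<alpha> 1 + 1 \<noteq> \<pi> 1 \<or> \<alpha> 2 \<noteq> \<pi> 2" "\<alpha> \<in> A"
    for \<alpha> v
  proof -
    have dd: "dual 1 \<in> Ie" "dual (dual 1) = 1" using dual_Ie[OF one] dual_dual one I_cases by auto
    let ?\<beta> = "\<alpha>(1 := \<alpha> 1 + 1)"
    have "?\<beta> \<in> A"
      using that by (auto simp: in_A_iff)
    moreover have "?\<beta> \<noteq> \<pi>"
    proof
      assume "?\<beta> = \<pi>"
      then have "?\<beta> 1 = \<pi> 1" "?\<beta> 2 = \<pi> 2" by simp_all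
      then show False using that(4) by simp
    qed
    ultimately have "inL ?\<beta> {}" by (rule inL_even)
    from inL_union[OF inL_eps_pair[OF dd(1) v] this dd(1)] have "inL (?\<beta> - eps 1) v"
      unfolding dd(2) by simp
    moreover have "?\<beta> - eps 1 = \<alpha>" by (auto simp: fun_eq_iff eps_apply)
    ultimately show ?thesis by simp
  qed
  obtain k s where ks: "u = {k, s}" "k \<noteq> s" using u(2) by (metis card_2_iff)
  obtain l where l: "l \<in> Io" "l \<notin> u"
    using u n_gt card_Io card_mono[of u Io] finite_subset[OF u(1) finite_Io] by fastforce
  define \<alpha> where "\<alpha> = \<pi>(1 := \<pi> 1 - 2)"
  define \<beta> where "\<beta> = (0 :: nat \<Rightarrow> nat)(1 := 2)"
  have ge: "3 \<le> \<pi> 1" "3 \<le> \<pi> 2" using \<pi>_ge one two by auto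
  have "inL \<alpha> {k, l}"
    using ks u l ge by (intro eps) (auto simp: \<alpha>_def in_A_iff)
  moreover have "inL \<beta> {l, s}"
    using ks u l ge by (intro eps) (auto simp: \<beta>_def in_A_iff)
  moreover have "{k, l} \<inter> {l, s} = {l}" using ks l by auto
  moreover have "\<alpha> + \<beta> = \<pi>" using ge by (auto simp: \<alpha>_def \<beta>_def fun_eq_iff)
  ultimately have "inL \<pi> ({k, l} \<union> {l, s} - {l})" by (rule inL_contract_top)
  moreover have "{k, l} \<union> {l, s} - {l} = u" using ks l by auto
  ultimately show ?thesis by simp
qed

text \<open>
  Adjoining two odd variables to a monomial with full exponent costs one even exponent, which may be
  chosen anywhere.
\<close>

lemma inL_add_two:
  assumes top: "\<And>v. v \<subseteq> Io \<Longrightarrow> card v + 2 = card u \<Longrightarrow> inL \<pi> v"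
    and u: "u \<subseteq> Io" "2 \<le> card u" and j: "j \<in> Ie"
  shows "inL (\<pi> - eps j) u"
proof -
  have dj: "dual j \<in> Ie" "dual (dual j) = j" using dual_Ie[OF j] dual_dual j I_cases by auto
  obtain v where v: "v \<subseteq> u" "card v = 2" using obtain_subset_with_card_n[OF u(2)] by blast
  have fin: "finite u" "finite v" using u v finite_subset[OF _ finite_Io] by auto
  have "inL \<pi> (u - v)"
    using u v fin by (intro top) (auto simp: card_Diff_subset)
  from inL_union[OF inL_eps_pair[OF dj(1) _ v(2)] this dj(1)]
  have "inL (\<pi> - eps j) (u - v \<union> v)"
    using u v \<pi>_ge[OF j] by (auto simp: dj(2))
  moreover have "u - v \<union> v = u" using v by auto
  ultimately show ?thesis by simp
qed

text \<open>
  Induction on the number of odd variables.  Replace some \<open>k \<in> u\<close> by an index \<open>l\<close> outside \<open>u\<close>: the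
  resulting set has the same size, so it is reached with exponent $\pi - \varepsilon_1$ by adjoining two
  variables, and contraction over \<open>l\<close> with $x_1 x_l x_k$ restores both \<open>u\<close> and the missing exponent.
\<close>

lemma inL_top:
  assumes "u \<subseteq> Io" "u \<noteq> Io" "even (card u)" "u \<noteq> {}"
  shows "inL \<pi> u"
  using assms
proof (induction "card u" arbitrary: u rule: less_induct)
  case less
  have fin: "finite u" using less.prems finite_subset[OF _ finite_Io] by blast
  have pos: "card u \<noteq> 0" using fin less.prems by simp
  show ?case
  proof (cases "card u = 2")
    case True
    then show ?thesis using inL_two less.prems by blast
  next
    case False
    then have four: "4 \<le> card u" using less.prems(3) pos by presburger
    have lt: "card u < card Io" using less.prems(1,2) by (simp add: psubset_card_mono psubset_eq)
    have one: "1 \<in> Ie" using m_gt by (auto simp: Y0_def)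
    have sub: "inL (\<pi> - eps 1) w" if w: "w \<subseteq> Io" "card w = card u" for w
    proof (rule inL_add_two[OF _ w(1) _ one])
      fix v assume v: "v \<subseteq> Io" "card v + 2 = card w"
      show "inL \<pi> v"
      proof (rule less.hyps)
        show "even (card v)" using v(2) w(2) less.prems(3) by presburger
      qed (use v w four lt in auto)
    qed (use four w in auto)
    obtain k where k: "k \<in> u" using less.prems(4) by blast
    obtain l where l: "l \<in> Io" "l \<notin> u" using less.prems(1,2) by blast
    have "inL (\<pi> - eps 1) (insert l (u - {k}))"
      using less.prems(1) l k fin card_Suc_Diff1[OF fin k] by (intro sub) auto
    moreover have "l \<noteq> k" using l k by blast
    then have "inL (eps 1) {l, k}"
      using l k less.prems(1) by (intro inL_eps_pair one) auto
    moreover have "insert l (u - {k}) \<inter> {l, k} = {l}" using l k by auto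
    moreover have "\<pi> - eps 1 + eps 1 = \<pi>" using \<pi>_ge[OF one] by (auto simp: fun_eq_iff eps_apply)
    ultimately have "inL \<pi> (insert l (u - {k}) \<union> {l, k} - {l})" by (rule inL_contract_top)
    moreover have "insert l (u - {k}) \<union> {l, k} - {l} = u" using l k by auto
    ultimately show ?thesis by simp
  qed
qed

lemma inL_all:
  assumes \<alpha>: "\<alpha> \<in> A" and u: "u \<subseteq> Io" "even (card u)"
    and not_top: "(\<alpha>, u) \<noteq> (\<pi>, Io)" "(\<alpha>, u) \<noteq> (\<pi>, {})"
  shows "inL \<alpha> u"
proof -
  consider "u = {}" | "u \<noteq> {}" "u \<noteq> Io" | "u = Io" by blast
  then show ?thesis
  proof cases
    case 1
    then show ?thesis using inL_even[OF \<alpha>] not_top by simp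
  next
    case 2
    then show ?thesis using inL_le[OF inL_top] u \<alpha> by (simp add: in_A_iff)
  next
    case 3
    then obtain j where j: "j \<in> Ie" "\<And>k. \<alpha> k \<le> (\<pi>(j := \<pi> j - 1)) k"
      using A_below_submaximal[OF \<alpha>] not_top by blast
    have "inL (\<pi> - eps j) Io"
    proof (rule inL_add_two[OF _ _ _ j(1)])
      fix v assume v: "v \<subseteq> Io" "card v + 2 = card Io"
      show "inL \<pi> v"
        by (rule inL_top) (use v u 3 n_gt card_Io in \<open>auto simp flip: even_add\<close>)
    qed (use n_gt card_Io in auto)
    moreover have "\<pi>(j := \<pi> j - 1) = \<pi> - eps j" by (auto simp: fun_eq_iff eps_apply)
    ultimately show ?thesis using j(2) inL_le 3 by metis
  qed
qed

lemma NN_subset: "NN p m n t \<subseteq> L"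
  unfolding NN_def
proof (rule witt.span_minimal)
  show "witt.subspace L" using L by (simp add: lie_subalgebra_def)
qed (use inL_all in \<open>auto simp: inL_def BB0_iff\<close>)

end

theorem theorem2p7:
  fixes p m n :: nat and t :: "nat \<Rightarrow> nat"
  assumes "CHAR('a::field) = p" and "p > 3" and "m > 1" and "n > 3"
    and "\<forall>i\<in>Y0 m. t i > 0"
  shows "lie_subalgebra p m n t hull
           (gensM p m n t \<union> gensN p m n t \<union> NNcomp p m n t 0)
         = (NN p m n t :: 'a witt set)"
proof -
  interpret hamiltonian_data p m n t "TYPE('a)"
    by unfold_locales (use assms in auto)
  show ?thesis
  proof (rule hull_unique)
    show "gensM p m n t \<union> gensN p m n t \<union> NNcomp p m n t 0 \<subseteq> (NN p m n t :: 'a witt set)"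
      by (rule generators_subset_NN)
    show "lie_subalgebra p m n t (NN p m n t :: 'a witt set)"
      by (rule lie_subalgebra_NN)
  next
    fix L :: "'a witt set"
    assume "gensM p m n t \<union> gensN p m n t \<union> NNcomp p m n t 0 \<subseteq> L" "lie_subalgebra p m n t L"
    then interpret generating_subalgebra p m n t "TYPE('a)" L
      by unfold_locales
    show "NN p m n t \<subseteq> L" by (rule NN_subset)
  qed
qed

end
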